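(* Let $X\subseteq\{0,1\}^{\mathbb Z}$ be a measure-theoretically subordinate subshift with base measure $\nu$ such that $h(\nu)=0$, and let $\varphi\colon X\to\mathbb R$ be of the form $\varphi(x)=\varphi(x_0)$. Then \[ \mathcal P_{X,\varphi}=\nu(0)\varphi(0)+\nu(1)\log_2\big(2^{\varphi(0)}+2^{\varphi(1)}\big), \] and there is a unique equilibrium state, namely $M_*(\nu\otimes B_p)$ with $p=2^{\varphi(0)}/(2^{\varphi(0)}+2^{\varphi(1)})$.
   Context: $\sigma$ is the left shift on $\{0,1\}^{\mathbb Z}$; $\mathcal M(Y)$ is the set of shift-invariant Borel probability measures on $Y$; $\nu(a)=\nu(\{x:x_0=a\})$. $B_p$ is the Bernoulli measure on $\{0,1\}^{\mathbb Z}$ with probability $p$ of the symbol $0$ and $1-p$ of the symbol $1$. Topological pressure of a subshift $X$ and continuous $\varphi$: $\mathcal P_{X,\varphi}=\lim_n\frac1n\log_2\sum_{A\in\mathcal L_n(X)}2^{\sup_{x\in A}\varphi^{(n)}(x)}$, where $\mathcal L_n(X)$ is the set of $n$-blocks occurring in $X$ (identified with cylinders) and $\varphi^{(n)}=\sum_{j<n}\varphi\circ\sigma^j$; by the variational principle $\mathcal P_{X,\varphi}=\sup_{\mu\in\mathcal M(X)}(h(\mu)+\int\varphi\,d\mu)$ (entropy base 2), and an equilibrium state is a measure attaining this supremum. $M(x,y)=x\cdot y$ coordinatewise, $\pi_1$ the first-coordinate projection. A subshift $X$ is a measure-theoretically subordinate subshift with base measure $\nu$ if $\mathcal M(X)=\{M_*(\lambda):\lambda\in\mathcal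 M((\{0,1\}^{\mathbb Z})^2,\sigma^{\times2}),(\pi_1)_*\lambda=\nu\}$. *)

theory Defs
  imports "HOL-Probability.Probability"
begin

text \<open>Configurations in the full shift: symbol 0 is False, symbol 1 is True.
  The measurable structure is the product sigma-algebra (= Borel sigma-algebra of
  the product topology, since the alphabet is finite and discrete).\<close>

type_synonym config = "int \<Rightarrow> bool"

definition Omega :: "config measure" where
  "Omega = Pi\<^sub>M UNIV (\<lambda>_::int. count_space (UNIV::bool set))"

definition shift :: "config \<Rightarrow> config" where
  "shift x = (\<lambda>i. x (i + 1))"

definition subshift :: "config set \<Rightarrow> bool" where
  "subshift X \<longleftrightarrow> X \<noteq> {} \<and> closed X \<and> shift ` X = X"

definition Minv :: "config set \<Rightarrow> config measure set" where
  "Minv Y = {\<mu>. sets \<mu> = sets Omega \<and> prob_space \<mu> \<and> distr \<mu> Omega shift = \<mu>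
                 \<and> (AE x in \<mu>. x \<in> Y)}"

definition Minv2 :: "(config \<times> config) measure set" where
  "Minv2 = {L. sets L = sets (Omega \<Otimes>\<^sub>M Omega) \<and> prob_space L
              \<and> distr L (Omega \<Otimes>\<^sub>M Omega) (\<lambda>(x, y). (shift x, shift y)) = L}"

definition Mmap :: "config \<times> config \<Rightarrow> config" where
  "Mmap p = (\<lambda>i. fst p i \<and> snd p i)"

definition meas_subordinate :: "config set \<Rightarrow> config measure \<Rightarrow> bool" where
  "meas_subordinate X \<nu> \<longleftrightarrow> subshift X \<and>
     Minv X = {distr L Omega Mmap | L. L \<in> Minv2 \<and> distr L Omega fst = \<nu>}"

definition cyl :: "bool list \<Rightarrow> config set" where
  "cyl w = {x. \<forall>i<length w. x (int i) = w ! i}"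

definition word :: "nat \<Rightarrow> config \<Rightarrow> bool list" where
  "word n x = map (\<lambda>i. x (int i)) [0..<n]"

definition lang :: "config set \<Rightarrow> nat \<Rightarrow> bool list set" where
  "lang X n = word n ` X"

text \<open>Measure-theoretic (Kolmogorov-Sinai) entropy in base 2, computed with the
  time-zero generating partition.\<close>
definition block_entropy :: "config measure \<Rightarrow> nat \<Rightarrow> real" where
  "block_entropy \<mu> n = - (\<Sum>w\<in>{w. length w = n}. measure \<mu> (cyl w) * log 2 (measure \<mu> (cyl w)))"

definition entropy_ms :: "config measure \<Rightarrow> real" where
  "entropy_ms \<mu> = lim (\<lambda>n. block_entropy \<mu> n / real n)"

definition birkhoff_sum :: "(config \<Rightarrow> real) \<Rightarrow> nat \<Rightarrow> config \<Rightarrow> real" where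
  "birkhoff_sum f n x = (\<Sum>j<n. f ((shift ^^ j) x))"

definition pressure :: "config set \<Rightarrow> (config \<Rightarrow> real) \<Rightarrow> real" where
  "pressure X f = lim (\<lambda>n. log 2 (\<Sum>w\<in>lang X n.
        2 powr (SUP x\<in>X \<inter> cyl w. birkhoff_sum f n x)) / real n)"

definition equilibrium_state :: "config set \<Rightarrow> (config \<Rightarrow> real) \<Rightarrow> config measure \<Rightarrow> bool" where
  "equilibrium_state X f \<mu> \<longleftrightarrow> \<mu> \<in> Minv X \<and>
     entropy_ms \<mu> + integral\<^sup>L \<mu> f = pressure X f"

text \<open>Bernoulli measure B_p: symbol 0 (False) with probability p.\<close>
definition bernoulli_shift :: "real \<Rightarrow> config measure" where
  "bernoulli_shift p = Pi\<^sub>M UNIV (\<lambda>_::int. measure_pmf (bernoulli_pmf (1 - p)))"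

definition sym_prob :: "config measure \<Rightarrow> bool \<Rightarrow> real" where
  "sym_prob \<nu> a = measure \<nu> {x. x 0 = a}"

end

theory Submission
  imports Defs
begin

text \<open>
  Put \<open>\<lambda>* = \<nu> \<otimes> B\<^sub>p\<close> and \<open>\<mu>* = M\<^sub>*(\<lambda>*)\<close>, and let \<open>c\<close> be the claimed pressure. For a coupling \<open>\<lambda>\<close> of \<open>\<nu>\<close> and
  \<open>\<mu> = M\<^sub>*(\<lambda>)\<close>, consider the law of the words \<open>(x, z)\<close>, \<open>z = M(x, y)\<close>, of length \<open>n\<close>. Under \<open>\<lambda>*\<close> the
  conditional law of \<open>z\<close> given \<open>x\<close> is the Gibbs kernel of \<open>\<phi>\<close>, so Gibbs' inequality reads
  \<open>H\<^sub>n(\<mu>) + n \<integral>\<phi> d\<mu> \<le> H\<^sub>n(\<nu>) + n c - D\<^sub>n\<close>, where \<open>D\<^sub>n\<close> is the relative entropy of the law of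
  \<open>(x, z)\<close> under \<open>\<lambda>\<close> with respect to \<open>\<lambda>*\<close>. As \<open>H\<^sub>n(\<nu>) = o(n)\<close>, this bounds the free energy by \<open>c\<close>,
  with equality at \<open>\<mu>*\<close>. The sequence \<open>D\<^sub>n\<close> is nonnegative and superadditive, hence vanishes
  identically for an equilibrium state, which is therefore \<open>\<mu>*\<close>.

  The lower bound for the pressure is Gibbs' inequality for \<open>\<mu>*\<close>. For the upper bound, let \<open>q\<close> be the
  law of \<open>k\<close>-words under \<open>\<mu>*\<close>, mixed with the uniform one. The cross entropy estimate bounds the integral of
  \<open>- log q + \<phi>\<^sup>(\<^sup>k\<^sup>)\<close> over every invariant measure on \<open>X\<close> by about \<open>k c\<close>; by weak compactness
  (Krylov--Bogoliubov) its Birkhoff averages on \<open>X\<close> are uniformly bounded likewise. Hence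
  \<open>2\<^sup>\<phi>\<close> of a long word is dominated by \<open>2\<^sup>n\<^sup>c\<close> times a product of values of \<open>q\<close>, and these products sum to
  at most 1.
\<close>

section \<open>Entropy of finite-valued random variables\<close>

definition law :: "'a measure \<Rightarrow> ('a \<Rightarrow> 'b) \<Rightarrow> 'b \<Rightarrow> real" where
  "law M X a = measure M {\<omega> \<in> space M. X \<omega> = a}"

text \<open>Shannon entropy in base 2 as the mean of the information function: estimates become
  almost everywhere comparisons of integrands, and values of mass zero drop out.\<close>

definition ent :: "'a measure \<Rightarrow> ('a \<Rightarrow> 'b) \<Rightarrow> real" where
  "ent M X = (\<integral>\<omega>. - log 2 (law M X (X \<omega>)) \<partial>M)"

lemma law_nonneg [simp]: "0 \<le> law M X a"
  by (simp add: law_def)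

lemma simple_function_level_sets:
  "simple_function M X \<Longrightarrow> {\<omega> \<in> space M. X \<omega> = a} \<in> sets M"
  using simple_functionD(2)[of M X "{a}"] by (simp add: vimage_def Int_def conj_commute)

lemma (in prob_space)
  fixes f :: "'b \<Rightarrow> real"
  assumes X: "simple_function M X"
  shows integrable_simple: "integrable M (\<lambda>\<omega>. f (X \<omega>))"
    and integral_simple: "(\<integral>\<omega>. f (X \<omega>) \<partial>M) = (\<Sum>a\<in>X ` space M. law M X a * f a)"
proof -
  have fin: "finite (X ` space M)" using X by (rule simple_functionD)
  have lv [measurable]: "{\<omega> \<in> space M. X \<omega> = a} \<in> sets M" for a
    using X by (rule simple_function_level_sets)
  define g where "g \<omega> = (\<Sum>a\<in>X ` space M. indicator {\<omega> \<in> space M. X \<omega> = a} \<omega> * f a)" for \<omega>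
  have eq: "f (X \<omega>) = g \<omega>" if "\<omega> \<in> space M" for \<omega>
  proof -
    have "g \<omega> = (\<Sum>a\<in>X ` space M. if X \<omega> = a then f a else 0)"
      unfolding g_def using that by (intro sum.cong) (auto simp: indicator_def)
    also have "\<dots> = f (X \<omega>)" using fin that by simp
    finally show ?thesis ..
  qed
  have ig: "integrable M g" unfolding g_def
    by (intro Bochner_Integration.integrable_sum integrable_mult_left integrable_real_indicator)
       (auto simp: less_top[symmetric])
  show "integrable M (\<lambda>\<omega>. f (X \<omega>))"
    by (subst Bochner_Integration.integrable_cong[OF refl eq]) (auto intro: ig)
  have "(\<integral>\<omega>. f (X \<omega>) \<partial>M) = integral\<^sup>L M g"
    by (rule Bochner_Integration.integral_cong[OF refl eq])
  also have "\<dots> = (\<Sum>a\<in>X ` space M. law M X a * f a)"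
    unfolding g_def law_def
    by (subst Bochner_Integration.integral_sum)
       (auto intro!: integrable_mult_left integrable_real_indicator sum.cong simp: less_top[symmetric] )
  finally show "(\<integral>\<omega>. f (X \<omega>) \<partial>M) = (\<Sum>a\<in>X ` space M. law M X a * f a)" .
qed

lemma (in prob_space) AE_law_pos:
  assumes X: "simple_function M X"
  shows "AE \<omega> in M. 0 < law M X (X \<omega>)"
proof -
  have fin: "finite (X ` space M)" using X by (rule simple_functionD)
  have "AE \<omega> in M. \<forall>a\<in>X ` space M. law M X a = 0 \<longrightarrow> X \<omega> \<noteq> a"
  proof (rule AE_finite_allI[OF fin])
    fix a
    show "AE \<omega> in M. law M X a = 0 \<longrightarrow> X \<omega> \<noteq> a"
    proof (cases "law M X a = 0")
      case True
      then have "{\<omega> \<in> space M. X \<omega> = a} \<in> null_sets M"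
        using simple_function_level_sets[OF X, of a]
        by (auto simp: law_def emeasure_eq_measure)
      from AE_not_in[OF this] show ?thesis by (auto intro: AE_mp)
    qed simp
  qed
  with AE_space show ?thesis
    by eventually_elim (auto simp: less_le)
qed

lemma (in prob_space) sum_law:
  assumes X: "simple_function M X"
  shows "(\<Sum>a\<in>X ` space M. law M X a) = 1"
  using integral_simple[OF X, of "\<lambda>_. 1"] by (simp add: prob_space)

text \<open>The tangent inequality ln t \<le> t - 1 at t = g / p; its equality case t = 1 gives the
  second claim.\<close>

lemma log_diff_ge:
  fixes p g :: real
  assumes "0 < p" "0 < g"
  shows "(p - g) / ln 2 \<le> p * (log 2 p - log 2 g)"
    and "(p - g) / ln 2 = p * (log 2 p - log 2 g) \<Longrightarrow> p = g"
proof -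
  have eq: "p * (log 2 p - log 2 g) = - p * ln (g / p) / ln 2"
    using assms by (simp add: log_def ln_div field_simps)
  have eq2: "p - g = - p * (g / p - 1)" using assms by (simp add: field_simps)
  have "ln (g / p) \<le> g / p - 1" using assms by (intro ln_le_minus_one) auto
  then have "- p * (g / p - 1) \<le> - p * ln (g / p)" using assms by simp
  then show "(p - g) / ln 2 \<le> p * (log 2 p - log 2 g)"
    unfolding eq eq2 by (intro divide_right_mono) auto
  assume "(p - g) / ln 2 = p * (log 2 p - log 2 g)"
  then have "ln (g / p) = g / p - 1" unfolding eq eq2 using assms by simp
  then have "g / p = 1" using assms by (intro ln_eq_minus_one) auto
  then show "p = g" using assms by simp
qed

lemma (in prob_space)
  fixes g :: "'b \<Rightarrow> real"
  assumes X: "simple_function M X"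
    and g0: "\<And>a. a \<in> X ` space M \<Longrightarrow> 0 \<le> g a" and g1: "(\<Sum>a\<in>X ` space M. g a) \<le> 1"
    and pos: "AE \<omega> in M. 0 < g (X \<omega>)"
  shows gibbs: "ent M X \<le> (\<integral>\<omega>. - log 2 (g (X \<omega>)) \<partial>M)"
    and gibbs_eq: "ent M X = (\<integral>\<omega>. - log 2 (g (X \<omega>)) \<partial>M) \<Longrightarrow> a \<in> X ` space M \<Longrightarrow> law M X a = g a"
proof -
  let ?A = "X ` space M" and ?p = "law M X"
  have fin: "finite ?A" using X by (rule simple_functionD)
  \<comment> \<open>A value of positive mass with \<open>g a = 0\<close> would contradict
    \<open>pos\<close>; hence logarithms are only compared at positive arguments.\<close>
  have gpos: "0 < g a" if "a \<in> ?A" "0 < ?p a" for a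
  proof (rule ccontr)
    assume "\<not> 0 < g a"
    with pos have "AE \<omega> in M. X \<omega> \<noteq> a"
      by (auto elim: eventually_mono)
    then have "?p a = 0"
      unfolding law_def using simple_function_level_sets[OF X, of a] by (simp add: prob_Collect_eq_0)
    with that show False by simp
  qed
  define d where "d a = ?p a * (log 2 (?p a) - log 2 (g a))" for a
  have le: "(?p a - g a) / ln 2 \<le> d a" if "a \<in> ?A" for a
  proof (cases "?p a = 0")
    case True
    with g0[OF that] show ?thesis by (simp add: d_def)
  next
    case False
    then have "0 < ?p a" by (simp add: less_le)
    with gpos[OF that] show ?thesis unfolding d_def by (intro log_diff_ge)
  qed
  have "0 \<le> (\<Sum>a\<in>?A. ?p a - g a) / ln 2"
    using sum_law[OF X] g1 by (simp add: sum_subtractf)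
  also have s: "\<dots> = (\<Sum>a\<in>?A. (?p a - g a) / ln 2)" by (simp add: sum_divide_distrib)
  finally have s0: "0 \<le> (\<Sum>a\<in>?A. (?p a - g a) / ln 2)" .
  have "(\<integral>\<omega>. - log 2 (g (X \<omega>)) \<partial>M) - ent M X = (\<Sum>a\<in>?A. d a)"
    unfolding ent_def integral_simple[OF X, of "\<lambda>a. - log 2 (g a)"]
      integral_simple[OF X, of "\<lambda>a. - log 2 (?p a)"] d_def
    by (simp add: sum_negf algebra_simps sum_subtractf)
  note diff = this
  show "ent M X \<le> (\<integral>\<omega>. - log 2 (g (X \<omega>)) \<partial>M)"
    using diff order_trans[OF s0 sum_mono[OF le]] by linarith
  assume "ent M X = (\<integral>\<omega>. - log 2 (g (X \<omega>)) \<partial>M)" and a: "a \<in> ?A"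
  then have "(\<Sum>a\<in>?A. d a) = 0" using diff by simp
  \<comment> \<open>The slacks are nonnegative and their sum is at most 0, so each one is 0.\<close>
  then have "(\<Sum>a\<in>?A. d a - (?p a - g a) / ln 2) \<le> 0"
    using s0 by (simp add: sum_subtractf)
  then have "(\<Sum>a\<in>?A. d a - (?p a - g a) / ln 2) = 0"
    by (rule antisym[OF _ sum_nonneg]) (simp add: le)
  then have e: "d a = (?p a - g a) / ln 2"
    using fin le a sum_nonneg_eq_0_iff[of ?A "\<lambda>a. d a - (?p a - g a) / ln 2"] by fastforce
  show "?p a = g a"
  proof (cases "?p a = 0")
    case True
    with e show ?thesis by (simp add: d_def)
  next
    case False
    then have p: "0 < ?p a" by (simp add: less_le)
    show ?thesis using log_diff_ge(2)[OF p gpos[OF a p] e[unfolded d_def, symmetric]] .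
  qed
qed

text \<open>\<open>ent\<close> only depends on the partition generated by its argument, which makes re-encodings free.\<close>

lemma ent_cong:
  assumes "\<And>\<omega> \<omega>'. \<omega> \<in> space M \<Longrightarrow> \<omega>' \<in> space M \<Longrightarrow> X \<omega> = X \<omega>' \<longleftrightarrow> Y \<omega> = Y \<omega>'"
  shows "ent M X = ent M Y"
  unfolding ent_def law_def
  by (intro Bochner_Integration.integral_cong refl arg_cong[where f = "\<lambda>x. - log 2 (measure M x)"])
     (use assms in blast)

section \<open>Image laws, marginals and subadditivity of entropy\<close>

lemma
  assumes f [measurable]: "f \<in> measurable M N" and X: "simple_function N X"
  shows law_distr: "law (distr M N f) X a = law M (\<lambda>\<omega>. X (f \<omega>)) a"
    and ent_distr: "ent (distr M N f) X = ent M (\<lambda>\<omega>. X (f \<omega>))"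
proof -
  have m: "X \<in> measurable N (count_space UNIV)"
    using X by (simp add: simple_function_eq_measurable)
  show *: "law (distr M N f) X a = law M (\<lambda>\<omega>. X (f \<omega>)) a" for a
    unfolding law_def using simple_function_level_sets[OF X, of a] measurable_space[OF f]
    by (subst measure_distr) (auto intro!: arg_cong[where f = "measure M"])
  show "ent (distr M N f) X = ent M (\<lambda>\<omega>. X (f \<omega>))"
    unfolding ent_def *
    by (subst integral_distr[OF f])
       (auto intro!: measurable_compose[OF m])
qed

lemma simple_function_comp_measurable:
  "f \<in> measurable M N \<Longrightarrow> simple_function N X \<Longrightarrow> simple_function M (\<lambda>\<omega>. X (f \<omega>))"
  by (auto simp: simple_function_eq_measurable intro: measurable_compose
      intro!: finite_subset[of _ "X ` space N"] dest: measurable_space)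

lemma (in prob_space) law_le_law:
  assumes X: "simple_function M X"
  shows "law M (\<lambda>\<omega>. (X \<omega>, Y \<omega>)) (a, b) \<le> law M X a"
  unfolding law_def by (rule finite_measure_mono) (auto intro!: simple_function_level_sets X)

lemma (in prob_space) law_marginal:
  assumes X: "simple_function M X" and Y: "simple_function M Y"
    and S: "finite S"
  shows "(\<Sum>b\<in>S. law M (\<lambda>\<omega>. (X \<omega>, Y \<omega>)) (a, b)) \<le> law M X a"
proof -
  have "(\<Sum>b\<in>S. law M (\<lambda>\<omega>. (X \<omega>, Y \<omega>)) (a, b)) = measure M (\<Union>b\<in>S. {\<omega> \<in> space M. (X \<omega>, Y \<omega>) = (a, b)})"
    unfolding law_def using S X Y
    by (intro finite_measure_finite_Union[symmetric])
       (auto simp: disjoint_family_on_def intro!: simple_function_level_sets)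
  also have "\<dots> \<le> law M X a"
    unfolding law_def by (rule finite_measure_mono) (auto intro!: simple_function_level_sets X)
  finally show ?thesis .
qed

text \<open>A pair of values has at most the mass of its first component, so the information
  function of the pair dominates wherever the mass is positive.\<close>

lemma (in prob_space) ent_mono:
  assumes X: "simple_function M X" and Y: "simple_function M Y"
  shows "ent M X \<le> ent M (\<lambda>\<omega>. (X \<omega>, Y \<omega>))"
  unfolding ent_def
proof (rule integral_mono_AE)
  let ?XY = "\<lambda>\<omega>. (X \<omega>, Y \<omega>)"
  have XY: "simple_function M ?XY" using X Y by simp
  show "integrable M (\<lambda>\<omega>. - log 2 (law M X (X \<omega>)))"
    using integrable_simple[OF X] .
  show "integrable M (\<lambda>\<omega>. - log 2 (law M ?XY (?XY \<omega>)))"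
    using integrable_simple[OF XY] .
  show "AE \<omega> in M. - log 2 (law M X (X \<omega>)) \<le> - log 2 (law M ?XY (?XY \<omega>))"
    using AE_law_pos[OF XY]
  proof eventually_elim
    case (elim \<omega>)
    with law_le_law[OF X, of Y "X \<omega>" "Y \<omega>"] show ?case by simp
  qed
qed

text \<open>\<open>H(V1, V2 | U1, U2) \<le> H(V1 | U1) + H(V2 | U2)\<close>, with the subtractions moved across.\<close>

lemma (in prob_space) cond_ent_subadd:
  assumes U1: "simple_function M U1" and U2: "simple_function M U2"
    and V1: "simple_function M V1" and V2: "simple_function M V2"
  shows "ent M (\<lambda>\<omega>. ((U1 \<omega>, V1 \<omega>), (U2 \<omega>, V2 \<omega>))) + ent M U1 + ent M U2
    \<le> ent M (\<lambda>\<omega>. (U1 \<omega>, U2 \<omega>)) + ent M (\<lambda>\<omega>. (U1 \<omega>, V1 \<omega>)) + ent M (\<lambda>\<omega>. (U2 \<omega>, V2 \<omega>))"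
proof -
  let ?X = "\<lambda>\<omega>. ((U1 \<omega>, V1 \<omega>), (U2 \<omega>, V2 \<omega>))"
  let ?U = "\<lambda>\<omega>. (U1 \<omega>, U2 \<omega>)" and ?W1 = "\<lambda>\<omega>. (U1 \<omega>, V1 \<omega>)" and ?W2 = "\<lambda>\<omega>. (U2 \<omega>, V2 \<omega>)"
  note [simp] = U1 U2 V1 V2
  have U: "simple_function M ?U" and W1: "simple_function M ?W1" and W2: "simple_function M ?W2"
    and X: "simple_function M ?X" by simp_all
  \<comment> \<open>The comparison weights \<open>g\<close> keep the joint law of \<open>U1\<close>
    and \<open>U2\<close> and then draw \<open>V1\<close> and \<open>V2\<close> independently from
    their conditional laws given \<open>U1\<close> and \<open>U2\<close>. Division by zero yields 0,
    so the conditional weights sum to at most 1 in every case.\<close>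
  define g1 where "g1 u v = law M ?W1 (u, v) / law M U1 u" for u v
  define g2 where "g2 u v = law M ?W2 (u, v) / law M U2 u" for u v
  define g where "g w = law M ?U (fst (fst w), fst (snd w)) * g1 (fst (fst w)) (snd (fst w))
      * g2 (fst (snd w)) (snd (snd w))" for w
  have sum1: "(\<Sum>v\<in>V1 ` space M. g1 u v) \<le> 1" for u
    using law_marginal[OF U1 V1 simple_functionD(1)[OF V1], of u]
    by (cases "law M U1 u = 0") (auto simp: g1_def sum_divide_distrib[symmetric] divide_le_eq less_le)
  have sum2: "(\<Sum>v\<in>V2 ` space M. g2 u v) \<le> 1" for u
    using law_marginal[OF U2 V2 simple_functionD(1)[OF V2], of u]
    by (cases "law M U2 u = 0") (auto simp: g2_def sum_divide_distrib[symmetric] divide_le_eq less_le)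
  have g10: "0 \<le> g1 u v" and g20: "0 \<le> g2 u' v'" for u v u' v' by (auto simp: g1_def g2_def)
  let ?A1 = "U1 ` space M" and ?A2 = "U2 ` space M" and ?B1 = "V1 ` space M" and ?B2 = "V2 ` space M"
  have fin: "finite ?A1" "finite ?A2" "finite ?B1" "finite ?B2"
    by (auto intro!: simple_functionD(1))
  have "(\<Sum>w\<in>?X ` space M. g w) \<le> (\<Sum>w\<in>(?A1 \<times> ?B1) \<times> (?A2 \<times> ?B2). g w)"
    using fin by (intro sum_mono2) (auto simp: g_def g10 g20)
  also have "\<dots> = (\<Sum>u1\<in>?A1. \<Sum>v1\<in>?B1. \<Sum>u2\<in>?A2. \<Sum>v2\<in>?B2. law M ?U (u1, u2) * g1 u1 v1 * g2 u2 v2)"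
    by (simp add: sum.cartesian_product' g_def)
  also have "\<dots> = (\<Sum>u1\<in>?A1. \<Sum>u2\<in>?A2. law M ?U (u1, u2) * (\<Sum>v1\<in>?B1. g1 u1 v1) * (\<Sum>v2\<in>?B2. g2 u2 v2))"
    unfolding sum.swap[of _ ?A2 ?B1]
    by (intro sum.cong refl, subst sum.swap) (simp add: sum_distrib_left sum_distrib_right mult.assoc)
  also have "\<dots> \<le> (\<Sum>u1\<in>?A1. \<Sum>u2\<in>?A2. law M ?U (u1, u2) * 1 * 1)"
    by (intro sum_mono mult_mono sum1 sum2) (auto intro!: sum_nonneg g10 g20)
  also have "\<dots> = (\<Sum>u1\<in>?A1. \<Sum>u2\<in>?A2. law M ?U (u1, u2))" by simp
  also have "\<dots> \<le> (\<Sum>u1\<in>?A1. law M U1 u1)"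
    by (intro sum_mono law_marginal) (auto intro!: simple_functionD(1))
  also have "\<dots> = 1" by (rule sum_law) simp
  finally have g1': "(\<Sum>w\<in>?X ` space M. g w) \<le> 1" .
  have pos: "AE \<omega> in M. 0 < law M ?U (?U \<omega>) \<and> 0 < law M ?W1 (?W1 \<omega>) \<and> 0 < law M ?W2 (?W2 \<omega>)
      \<and> 0 < law M U1 (U1 \<omega>) \<and> 0 < law M U2 (U2 \<omega>)"
    by (intro AE_conjI AE_law_pos) auto
  have "ent M ?X \<le> (\<integral>\<omega>. - log 2 (g (?X \<omega>)) \<partial>M)"
  proof (rule gibbs[OF X _ g1'])
    show "AE \<omega> in M. 0 < g (?X \<omega>)"
      using pos by eventually_elim (auto simp: g_def g1_def g2_def)
  qed (auto simp: g_def g10 g20)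
  also have "\<dots> = (\<integral>\<omega>. - log 2 (law M ?U (?U \<omega>)) + - log 2 (law M ?W1 (?W1 \<omega>)) + - log 2 (law M ?W2 (?W2 \<omega>))
      - (- log 2 (law M U1 (U1 \<omega>))) - (- log 2 (law M U2 (U2 \<omega>))) \<partial>M)"
  proof (rule integral_cong_AE)
    show "(\<lambda>\<omega>. - log 2 (g (?X \<omega>))) \<in> borel_measurable M"
      by (rule borel_measurable_integrable[OF integrable_simple[OF X, of "\<lambda>w. - log 2 (g w)"]])
    show "AE \<omega> in M. - log 2 (g (?X \<omega>)) = - log 2 (law M ?U (?U \<omega>)) + - log 2 (law M ?W1 (?W1 \<omega>))
        + - log 2 (law M ?W2 (?W2 \<omega>)) - (- log 2 (law M U1 (U1 \<omega>))) - (- log 2 (law M U2 (U2 \<omega>)))"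
      using pos by eventually_elim (simp add: g_def g1_def g2_def log_mult_pos log_divide_pos)
  qed (intro borel_measurable_integrable Bochner_Integration.integrable_add
      Bochner_Integration.integrable_diff integrable_simple[OF U] integrable_simple[OF W1]
      integrable_simple[OF W2] integrable_simple[OF U1] integrable_simple[OF U2])
  also have "\<dots> = ent M ?U + ent M ?W1 + ent M ?W2 - ent M U1 - ent M U2"
    unfolding ent_def
    by (simp add: integrable_simple[OF U, of "\<lambda>a. log 2 (law M ?U a)"]
       integrable_simple[OF W1, of "\<lambda>a. log 2 (law M ?W1 a)"] integrable_simple[OF W2, of "\<lambda>a. log 2 (law M ?W2 a)"]
       integrable_simple[OF U1, of "\<lambda>a. log 2 (law M U1 a)"] integrable_simple[OF U2, of "\<lambda>a. log 2 (law M U2 a)"])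
  finally show ?thesis by linarith
qed

text \<open>The case of constant \<open>U1\<close> and \<open>U2\<close>, whose entropies
  vanish.\<close>

lemma (in prob_space) ent_subadd:
  assumes V1: "simple_function M V1" and V2: "simple_function M V2"
  shows "ent M (\<lambda>\<omega>. (V1 \<omega>, V2 \<omega>)) \<le> ent M V1 + ent M V2"
proof -
  have 0: "ent M (\<lambda>_. ()) = 0" "ent M (\<lambda>_. ((), ())) = 0"
    by (auto simp: ent_def law_def prob_space)
  have "ent M (\<lambda>\<omega>. (((), V1 \<omega>), ((), V2 \<omega>))) = ent M (\<lambda>\<omega>. (V1 \<omega>, V2 \<omega>))"
    "ent M (\<lambda>\<omega>. ((), V1 \<omega>)) = ent M V1" "ent M (\<lambda>\<omega>. ((), V2 \<omega>)) = ent M V2"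
    by (auto intro!: ent_cong)
  with cond_ent_subadd[of "\<lambda>_. ()" "\<lambda>_. ()" V1 V2] V1 V2 0 show ?thesis by simp
qed

text \<open>Fekete's lemma; the limit is the infimum of the quotients with n \<ge> 1, which
  nonnegativity bounds from below.\<close>

lemma subadditive_convergent:
  fixes a :: "nat \<Rightarrow> real"
  assumes sub: "\<And>m n. a (m + n) \<le> a m + a n" and nonneg: "\<And>n. 0 \<le> a n"
  shows "convergent (\<lambda>n. a n / real n)"
proof -
  define l where "l = (INF n\<in>{1..}. a n / real n)"
  have bdd: "bdd_below ((\<lambda>n. a n / real n) ` {1..})"
    by (rule bdd_belowI[of _ 0]) (auto simp: nonneg)
  have low: "l \<le> a n / real n" if "n \<ge> 1" for n
    unfolding l_def using that by (intro cINF_lower bdd) auto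
  \<comment> \<open>The extra summand covers m = 0, where subadditivity gives no upper bound on
    \<open>a 0\<close> by 0.\<close>
  have mul: "a (m * k) \<le> real m * a k + (if m = 0 then a 0 else 0)" for m k
  proof (induction m)
    case (Suc m)
    show ?case
    proof (cases "m = 0")
      case False
      then show ?thesis using Suc sub[of k "m * k"] by (simp add: algebra_simps)
    qed simp
  qed simp
  have "(\<lambda>n. a n / real n) \<longlonglongrightarrow> l"
  proof (rule tendstoI)
    fix e :: real assume e: "0 < e"
    have "\<exists>x\<in>(\<lambda>n. a n / real n) ` {1..}. x < l + e / 2"
      unfolding l_def using bdd e by (subst cInf_less_iff[symmetric]) auto
    then obtain k where k: "k \<ge> 1" "a k / real k < l + e / 2" by auto
    \<comment> \<open>A bound, uniform in n, for the remainder \<open>a (n mod k)\<close> together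
      with the \<open>a 0\<close> from \<open>mul\<close>.\<close>
    define C where "C = a 0 + (\<Sum>r<k. a r)"
    have C: "a r \<le> (\<Sum>r<k. a r)" if "r < k" for r
      using that by (intro member_le_sum) (auto simp: nonneg)
    have bound: "a n \<le> real n * (a k / real k) + C" for n
    proof -
      have "a n \<le> a (n div k * k) + a (n mod k)" using sub[of "n div k * k" "n mod k"] by simp
      also have "\<dots> \<le> (real (n div k) * a k + a 0) + (\<Sum>r<k. a r)"
        using mul[of "n div k" k] C[of "n mod k"] k nonneg[of 0] by (intro add_mono) (auto split: if_splits)
      also have "real (n div k) * a k \<le> (real n / real k) * a k"
        by (intro mult_right_mono nonneg) (rule of_nat_div_le_of_nat)
      finally show ?thesis by (simp add: C_def)
    qed
    obtain N where N: "real N > 2 * C / e" using reals_Archimedean2 by blast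
    show "\<forall>\<^sub>F n in sequentially. dist (a n / real n) l < e"
      using eventually_ge_at_top[of "max 1 N"]
    proof eventually_elim
      case (elim n)
      then have n: "n \<ge> 1" "real n > 2 * C / e" using N by auto
      have "a n / real n \<le> a k / real k + C / real n"
        using bound[of n] n by (simp add: field_simps)
      moreover have "C / real n < e / 2" using n e by (simp add: field_simps)
      ultimately show ?case using low[OF n(1)] k(2) unfolding dist_real_def by linarith
    qed
  qed
  then show ?thesis by (rule convergentI)
qed

section \<open>Invariant measures from orbit averages\<close>

lemma space_Omega [simp]: "space Omega = UNIV"
  by (simp add: Omega_def space_PiM)

lemma coordinate_measurable [measurable]: "(\<lambda>x. x i) \<in> measurable Omega (count_space UNIV)"
  unfolding Omega_def by measurable

lemma simple_function_coordinates: "simple_function Omega (\<lambda>x. map x is)"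
proof (induction "is")
  case (Cons i "is")
  have "simple_function Omega (\<lambda>x. x i)"
    by (simp add: simple_function_eq_measurable coordinate_measurable)
  from simple_function_compose2[OF this Cons.IH, of "(#)"] show ?case by simp
qed simp

lemma simple_function_word: "simple_function Omega (word n)"
  using simple_function_coordinates[of "map int [0..<n]"] by (simp add: word_def[abs_def] comp_def)

lemma measurable_OmegaI:
  assumes "\<And>i. (\<lambda>\<omega>. f \<omega> i) \<in> measurable M (count_space UNIV)"
  shows "f \<in> measurable M Omega"
  unfolding Omega_def by (rule measurable_PiM_single') (use assms in auto)

lemma shift_measurable [measurable]: "shift \<in> measurable Omega Omega"
  by (rule measurable_OmegaI) (simp add: shift_def coordinate_measurable)

lemma shift_pow_measurable [measurable]: "shift ^^ m \<in> measurable Omega Omega"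
  by (induction m) (auto intro: measurable_comp)

lemma shift_pow_apply: "(shift ^^ m) x i = x (i + int m)"
  by (induction m arbitrary: i) (auto simp: shift_def algebra_simps)

lemma Mmap_measurable [measurable]: "Mmap \<in> measurable (Omega \<Otimes>\<^sub>M Omega) Omega"
  by (rule measurable_OmegaI) (unfold Mmap_def, measurable)

lemma cyl_eq_word: "cyl w = {x. word (length w) x = w}"
proof -
  have "word (length w) x = w \<longleftrightarrow> (\<forall>i<length w. x (int i) = w ! i)" for x
    unfolding word_def by (subst list_eq_iff_nth_eq) simp
  then show ?thesis by (simp add: cyl_def)
qed

lemma length_word [simp]: "length (word n x) = n"
  by (simp add: word_def)

lemma surj_word: "range (word n) = {w. length w = n}"
proof (intro equalityI subsetI)
  fix w :: "bool list" assume "w \<in> {w. length w = n}"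
  then have "w = word n (\<lambda>i. w ! nat i)" by (intro nth_equalityI) (auto simp: word_def)
  then show "w \<in> range (word n)" by blast
qed auto

text \<open>By compactness these are exactly the clopen sets. They form an algebra generating the
  sigma-algebra, and being closed they allow compactness arguments.\<close>

definition local_sets :: "config set set" where
  "local_sets = {A. \<exists>m::nat. \<forall>x y. (\<forall>i. \<bar>i\<bar> \<le> int m \<longrightarrow> x i = y i) \<longrightarrow> (x \<in> A \<longleftrightarrow> y \<in> A)}"

lemma local_setsI:
  "(\<And>x y. (\<And>i. \<bar>i\<bar> \<le> int m \<Longrightarrow> x i = y i) \<Longrightarrow> x \<in> A \<longleftrightarrow> y \<in> A) \<Longrightarrow> A \<in> local_sets"
  unfolding local_sets_def by blast

lemma local_sets_Collect_word: "{x. P (word n ((shift ^^ m) x))} \<in> local_sets"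
proof (rule local_setsI[where m = "n + m"])
  fix x y :: config assume "\<And>i. \<bar>i\<bar> \<le> int (n + m) \<Longrightarrow> x i = y i"
  then have "word n ((shift ^^ m) x) = word n ((shift ^^ m) y)"
    by (auto simp: word_def shift_pow_apply)
  then show "x \<in> {x. P (word n ((shift ^^ m) x))} \<longleftrightarrow> y \<in> {x. P (word n ((shift ^^ m) x))}" by simp
qed

lemma algebra_local_sets: "algebra UNIV local_sets"
  unfolding algebra_iff_Un
proof (intro conjI ballI)
  fix A B assume "A \<in> local_sets" "B \<in> local_sets"
  then obtain m n where
    m: "\<And>x y. (\<forall>i. \<bar>i\<bar> \<le> int m \<longrightarrow> x i = y i) \<Longrightarrow> x \<in> A \<longleftrightarrow> y \<in> A" and
    n: "\<And>x y. (\<forall>i. \<bar>i\<bar> \<le> int n \<longrightarrow> x i = y i) \<Longrightarrow> x \<in> B \<longleftrightarrow> y \<in> B"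
    unfolding local_sets_def by blast
  show "A \<union> B \<in> local_sets"
  proof (rule local_setsI[where m = "max m n"])
    fix x y :: config assume "\<And>i. \<bar>i\<bar> \<le> int (max m n) \<Longrightarrow> x i = y i"
    then show "x \<in> A \<union> B \<longleftrightarrow> y \<in> A \<union> B" using m[of x y] n[of x y] by auto
  qed
qed (auto simp: local_sets_def)

lemma local_sets_sets_Omega:
  assumes "A \<in> local_sets" shows "A \<in> sets Omega"
proof -
  obtain m where m: "\<And>x y. (\<forall>i. \<bar>i\<bar> \<le> int m \<longrightarrow> x i = y i) \<Longrightarrow> x \<in> A \<longleftrightarrow> y \<in> A"
    using assms unfolding local_sets_def by blast
  let ?W = "\<lambda>x::config. map x [- int m..int m]"
  have "x \<in> A \<longleftrightarrow> y \<in> A" if "?W x = ?W y" for x y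
    using that by (intro m) (auto simp: abs_le_iff)
  then have "A = ?W -` (?W ` A)" by blast
  also have "\<dots> \<in> sets Omega"
    using simple_functionD(2)[OF simple_function_coordinates[of "[- int m..int m]"], of "?W ` A"] by simp
  finally show ?thesis .
qed

lemma sets_Omega: "sets Omega = sigma_sets UNIV local_sets"
proof
  have "{f. f i \<in> A} \<in> local_sets" for i :: int and A :: "bool set"
    by (rule local_setsI[where m = "nat \<bar>i\<bar>"]) auto
  then show "sets Omega \<subseteq> sigma_sets UNIV local_sets"
    unfolding Omega_def sets_PiM_single by (simp add: PiE_UNIV_domain) (intro sigma_sets_mono'; auto)
  show "sigma_sets UNIV local_sets \<subseteq> sets Omega"
    using local_sets_sets_Omega sets.sigma_sets_subset[of local_sets Omega] by auto
qed

lemma local_measure_eqI: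
  assumes M: "sets M = sets Omega" "prob_space M" and N: "sets N = sets Omega" "prob_space N"
    and eq: "\<And>A. A \<in> local_sets \<Longrightarrow> measure M A = measure N A"
  shows "M = N"
proof (rule measure_eqI_generator_eq[where E = local_sets and \<Omega> = UNIV and A = "\<lambda>_. UNIV"])
  interpret A: algebra UNIV local_sets by (rule algebra_local_sets)
  interpret M: prob_space M by fact
  interpret N: prob_space N by fact
  show "Int_stable local_sets" by (auto simp: Int_stable_def)
  show "range (\<lambda>_. UNIV) \<subseteq> local_sets" by auto
  show "emeasure M A = emeasure N A" if "A \<in> local_sets" for A
    using eq[OF that] by (simp add: M.emeasure_eq_measure N.emeasure_eq_measure)
qed (use M N in \<open>auto simp: sets_Omega prob_space.finite_measure finite_measure.emeasure_eq_measure\<close>)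

section \<open>Compactness of the full shift and the Krylov--Bogoliubov construction\<close>

lemma compact_UNIV_config: "compact (UNIV :: config set)"
proof -
  have "compact (UNIV :: bool set)" by (simp add: finite_imp_compact)
  then have "compactin (product_topology (\<lambda>i::int. euclidean :: bool topology) UNIV) (PiE UNIV (\<lambda>_. UNIV))"
    by (subst compactin_PiE) simp
  then show ?thesis by (simp add: euclidean_product_topology)
qed

lemma open_local_set:
  assumes "A \<in> local_sets" shows "open A"
proof -
  obtain m where m: "\<And>x y. (\<forall>i. \<bar>i\<bar> \<le> int m \<longrightarrow> x i = y i) \<Longrightarrow> x \<in> A \<longleftrightarrow> y \<in> A"
    using assms unfolding local_sets_def by blast
  show ?thesis
  proof (subst open_subopen, intro ballI)
    fix x assume x: "x \<in> A"
    define T where "T = Pi\<^sub>E UNIV (\<lambda>i. if \<bar>i\<bar> \<le> int m then {x i} else UNIV)"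
    have "finite {i::int. \<bar>i\<bar> \<le> int m}"
      by (rule finite_subset[of _ "{- int m..int m}"]) auto
    then have "finite {i::int. (if \<bar>i\<bar> \<le> int m then {x i} else UNIV) \<noteq> UNIV}"
      by (rule finite_subset[rotated]) auto
    moreover have "open (if \<bar>i\<bar> \<le> int m then {x i} else UNIV)" for i
      by (rule Topological_Spaces.open_discrete)
    ultimately have "open T" unfolding T_def by (intro open_PiE)
    moreover have "x \<in> T" by (auto simp: T_def)
    moreover have "T \<subseteq> A"
    proof
      fix y assume y: "y \<in> T"
      have "x i = y i" if "\<bar>i\<bar> \<le> int m" for i
        using PiE_mem[OF y[unfolded T_def], of i] that by simp
      with m[of x y] x show "y \<in> A" by blast
    qed
    ultimately show "\<exists>T. open T \<and> x \<in> T \<and> T \<subseteq> A" by blast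
  qed
qed

lemma closed_local_set: "A \<in> local_sets \<Longrightarrow> closed A"
  using open_local_set[of "- A"] algebra_local_sets
  by (auto simp: closed_def algebra_iff_Un Compl_eq_Diff_UNIV)

text \<open>Caratheodory's theorem. Continuity at the empty set is automatic: a decreasing sequence
  of nonempty clopen sets has a common point, so one with empty intersection is eventually
  empty.\<close>

lemma local_content_extends:
  fixes q :: "config set \<Rightarrow> real"
  assumes nonneg: "\<And>A. A \<in> local_sets \<Longrightarrow> 0 \<le> q A" and one: "q UNIV = 1"
    and add: "\<And>A B. A \<in> local_sets \<Longrightarrow> B \<in> local_sets \<Longrightarrow> A \<inter> B = {} \<Longrightarrow> q (A \<union> B) = q A + q B"
  obtains \<mu> where "sets \<mu> = sets Omega" "prob_space \<mu>" "\<And>A. A \<in> local_sets \<Longrightarrow> measure \<mu> A = q A"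
proof -
  interpret A: algebra UNIV local_sets by (rule algebra_local_sets)
  have empty: "q {} = 0" using add[of "{}" "{}"] by simp
  have "\<exists>m :: config set \<Rightarrow> ennreal. (\<forall>s \<in> local_sets. m s = ennreal (q s))
      \<and> measure_space UNIV (sigma_sets UNIV local_sets) m"
  proof (rule A.caratheodory_empty_continuous)
    show "positive local_sets (\<lambda>s. ennreal (q s))" by (simp add: positive_def empty)
    show "additive local_sets (\<lambda>s. ennreal (q s))"
      by (auto simp: additive_def add ennreal_plus[symmetric] nonneg simp del: ennreal_plus)
    fix A :: "nat \<Rightarrow> config set"
    assume A: "range A \<subseteq> local_sets" and dec: "decseq A" and int: "(\<Inter>i. A i) = {}"
    have "\<exists>i. A i = {}"
    proof (rule ccontr)
      assume ne: "\<not> ?thesis"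
      have "UNIV \<inter> (\<Inter>i\<in>UNIV. A i) \<noteq> {}"
      proof (rule compact_imp_fip_image[OF compact_UNIV_config])
        show "closed (A i)" for i using A by (auto intro: closed_local_set)
        fix I :: "nat set" assume I: "finite I" "I \<subseteq> UNIV"
        have "A (Max (insert 0 I)) \<subseteq> A i" if "i \<in> I" for i
          using I that by (intro decseqD[OF dec]) auto
        with ne show "UNIV \<inter> (\<Inter>i\<in>I. A i) \<noteq> {}" by blast
      qed
      with int show False by simp
    qed
    then obtain i where i: "A i = {}" ..
    have "A n = {}" if "n \<ge> i" for n using decseqD[OF dec that] i by auto
    then have "eventually (\<lambda>n. ennreal (q (A n)) = 0) sequentially"
      by (intro eventually_sequentiallyI[of i]) (simp add: empty)
    then show "(\<lambda>n. ennreal (q (A n))) \<longlonglongrightarrow> 0" by (rule tendsto_eventually)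
  qed simp
  then obtain m :: "config set \<Rightarrow> ennreal" where m: "\<And>s. s \<in> local_sets \<Longrightarrow> m s = ennreal (q s)"
    and ms: "measure_space UNIV (sigma_sets UNIV local_sets) m" by blast
  define \<mu> where "\<mu> = measure_of UNIV local_sets m"
  have sets: "sets \<mu> = sets Omega" by (simp add: \<mu>_def sets_Omega)
  have em: "emeasure \<mu> A = ennreal (q A)" if "A \<in> local_sets" for A
    using that ms m[OF that]
    by (subst emeasure_measure_of[OF \<mu>_def]) (auto simp: measure_space_def sets sets_Omega)
  show thesis
  proof (rule that[OF sets])
    show "prob_space \<mu>"
      using em[of UNIV] by (intro prob_spaceI) (simp add: one \<mu>_def)
    show "measure \<mu> A = q A" if "A \<in> local_sets" for A
      using em[OF that] nonneg[OF that] by (simp add: measure_def)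
  qed
qed

text \<open>Tychonoff's theorem for a power of [0,1]. The exponent may be uncountable, as it is when
  \<open>E n\<close> is an empirical measure on all sets of configurations, so a filter replaces a
  convergent subsequence.\<close>

lemma pointwise_cluster_filter:
  fixes E :: "nat \<Rightarrow> 'a \<Rightarrow> real"
  assumes "\<And>n A. 0 \<le> E n A" "\<And>n A. E n A \<le> 1"
  obtains q G where "G \<noteq> bot" "G \<le> sequentially" "\<And>A. ((\<lambda>n. E n A) \<longlongrightarrow> q A) G"
proof -
  define K :: "('a \<Rightarrow> real) set" where "K = PiE UNIV (\<lambda>_. {0..1})"
  have "compactin (product_topology (\<lambda>i::'a. euclidean :: real topology) UNIV) K"
    unfolding K_def by (subst compactin_PiE) simp
  then have K: "compact K" by (simp add: euclidean_product_topology)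
  have "eventually (\<lambda>x. x \<in> K) (filtermap E sequentially)"
    using assms by (simp add: eventually_filtermap K_def PiE_UNIV_domain)
  moreover have "filtermap E sequentially \<noteq> bot" by (simp add: filtermap_bot_iff)
  ultimately obtain q where "inf (nhds q) (filtermap E sequentially) \<noteq> bot"
    using K unfolding compact_filter by blast
  \<comment> \<open>Compactness gives a cluster point of the image filter; this pulls it back to a
    proper filter on the indices.\<close>
  then have ne: "inf (filtercomap E (nhds q)) sequentially \<noteq> bot"
  proof (rule contrapos_nn)
    assume "inf (filtercomap E (nhds q)) sequentially = bot"
    then obtain Q R where Q: "eventually Q (nhds q)" and R: "eventually R sequentially"
      and QR: "\<And>n. Q (E n) \<Longrightarrow> R n \<Longrightarrow> False"
      unfolding trivial_limit_def eventually_inf eventually_filtercomap by blast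
    have "eventually (\<lambda>f. \<not> Q f) (filtermap E sequentially)"
      unfolding eventually_filtermap using R by (rule eventually_mono) (use QR in blast)
    with Q show "inf (nhds q) (filtermap E sequentially) = bot"
      unfolding trivial_limit_def eventually_inf by blast
  qed
  have lim: "(E \<longlongrightarrow> q) (inf (filtercomap E (nhds q)) sequentially)"
    by (rule filterlim_mono[OF filterlim_filtercomap order_refl inf_le1])
  have "((\<lambda>n. E n A) \<longlongrightarrow> q A) (inf (filtercomap E (nhds q)) sequentially)" for A
  proof (rule topological_tendstoI)
    fix S :: "real set" assume S: "open S" "q A \<in> S"
    have "open ((\<lambda>f :: 'a \<Rightarrow> real. f A) -` S)"
      using S(1) by (rule open_vimage[OF _ continuous_on_product_coordinates])
    with S(2) show "eventually (\<lambda>n. E n A \<in> S) (inf (filtercomap E (nhds q)) sequentially)"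
      using topological_tendstoD[OF lim, of "(\<lambda>f. f A) -` S"] by simp
  qed
  then show thesis using that[OF ne inf_le2] by blast
qed

text \<open>If the bound fails, there are arbitrarily long orbit segments in \<open>X\<close> with
  average at least \<open>a\<close>. A cluster point of their empirical measures extends to an
  invariant measure on \<open>X\<close> whose integral is at least \<open>a\<close>, against
  \<open>h\<close>.\<close>

lemma birkhoff_uniform_bound:
  fixes h :: "bool list \<Rightarrow> real"
  assumes X: "subshift X"
    and h: "\<And>\<mu>. \<mu> \<in> Minv X \<Longrightarrow> (\<integral>x. h (word k x) \<partial>\<mu>) < a"
  shows "\<exists>N. \<forall>n\<ge>N. \<forall>x\<in>X. (\<Sum>m<n. h (word k ((shift ^^ m) x))) < real n * a"
proof (rule ccontr)
  assume "\<not> ?thesis"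
  then have "\<forall>N. \<exists>n x. n \<ge> Suc N \<and> x \<in> X \<and> real n * a \<le> (\<Sum>m<n. h (word k ((shift ^^ m) x)))"
    by (meson linorder_not_less)
  then obtain n x where n: "\<And>N. n N \<ge> Suc N" and xX: "\<And>N. x N \<in> X"
    and big: "\<And>N. real (n N) * a \<le> (\<Sum>m<n N. h (word k ((shift ^^ m) (x N))))"
    by metis
  \<comment> \<open>\<open>E N\<close> is the empirical measure of the N-th bad segment. Its cluster
    point is finitely additive on all sets; only the restriction to local sets is extended to a
    measure.\<close>
  define E :: "nat \<Rightarrow> config set \<Rightarrow> real" where
    "E N A = (\<Sum>m<n N. indicator A ((shift ^^ m) (x N))) / real (n N)" for N A
  have n0: "n N > 0" for N using n[of N] by simp
  have E0: "0 \<le> E N A" for N A by (auto simp: E_def intro!: divide_nonneg_nonneg sum_nonneg)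
  have E1: "E N A \<le> 1" for N A
  proof -
    have "(\<Sum>m<n N. indicator A ((shift ^^ m) (x N))) \<le> (\<Sum>m<n N. 1 :: real)"
      by (intro sum_mono) (auto simp: indicator_def)
    then show ?thesis using n0[of N] by (simp add: E_def)
  qed
  obtain q G where G: "G \<noteq> bot" "G \<le> sequentially" and q: "\<And>A. ((\<lambda>N. E N A) \<longlongrightarrow> q A) G"
    by (rule pointwise_cluster_filter[of E, OF E0 E1]) blast
  have EUNIV: "E N UNIV = 1" for N using n0[of N] by (simp add: E_def)
  have add: "q (A \<union> B) = q A + q B" if "A \<inter> B = {}" for A B
  proof (rule tendsto_unique[OF G(1) q])
    have "E N (A \<union> B) = E N A + E N B" for N
    proof -
      have "indicator (A \<union> B) z = (indicator A z + indicator B z :: real)" for z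
        using that by (auto simp: indicator_def)
      then show ?thesis by (simp add: E_def sum.distrib add_divide_distrib)
    qed
    then show "((\<lambda>N. E N (A \<union> B)) \<longlongrightarrow> q A + q B) G" using tendsto_add[OF q q] by simp
  qed
  have q0: "0 \<le> q A" for A
    using tendsto_lowerbound[OF q] E0 G by simp
  have q1: "q UNIV = 1"
    using tendsto_unique[OF G(1) q, of UNIV 1] by (simp add: EUNIV)
  obtain \<mu> where sets: "sets \<mu> = sets Omega" and ps: "prob_space \<mu>"
    and \<mu>: "\<And>A. A \<in> local_sets \<Longrightarrow> measure \<mu> A = q A"
    using local_content_extends[of q] q0 q1 add by metis
  interpret prob_space \<mu> by fact
  have sp: "space \<mu> = UNIV" using sets_eq_imp_space_eq[OF sets] by simp
  have ms: "f \<in> measurable \<mu> N \<longleftrightarrow> f \<in> measurable Omega N" for f and N :: "'z measure"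
    by (simp add: measurable_cong_sets[OF sets refl])
  have inv: "distr \<mu> Omega shift = \<mu>"
  proof (rule local_measure_eqI)
    show "prob_space (distr \<mu> Omega shift)" by (rule prob_space_distr) (simp add: ms)
    fix A assume A: "A \<in> local_sets"
    then obtain m where m: "\<And>x y. (\<forall>i. \<bar>i\<bar> \<le> int m \<longrightarrow> x i = y i) \<Longrightarrow> x \<in> A \<longleftrightarrow> y \<in> A"
      unfolding local_sets_def by blast
    have A': "shift -` A \<in> local_sets"
    proof (rule local_setsI[where m = "Suc m"])
      fix x y :: config assume xy: "\<And>i. \<bar>i\<bar> \<le> int (Suc m) \<Longrightarrow> x i = y i"
      have "shift x \<in> A \<longleftrightarrow> shift y \<in> A" unfolding shift_def by (rule m) (auto intro!: xy)
      then show "x \<in> shift -` A \<longleftrightarrow> y \<in> shift -` A" by simp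
    qed
    have "q (shift -` A) - q A = 0"
    proof (rule tendsto_unique[OF G(1) tendsto_diff[OF q q]])
      \<comment> \<open>The sums telescope: the frequencies of a set and of its preimage differ only
        by the two ends of the segment.\<close>
      have eq: "E N (shift -` A) - E N A
          = (indicator A ((shift ^^ n N) (x N)) - indicator A (x N)) / real (n N)" for N
      proof -
        have "E N (shift -` A) = (\<Sum>m<n N. indicator A ((shift ^^ Suc m) (x N))) / real (n N)"
          by (simp add: E_def indicator_def)
        then have "E N (shift -` A) - E N A = (\<Sum>m<n N. indicator A ((shift ^^ Suc m) (x N))
           - indicator A ((shift ^^ m) (x N))) / real (n N)"
          by (simp add: E_def sum_subtractf diff_divide_distrib)
        then show ?thesis
          by (subst (asm) sum_lessThan_telescope) simp
      qed
      have bnd: "norm (E N (shift -` A) - E N A) \<le> 1 / real (Suc N)" for N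
      proof -
        have "\<bar>E N (shift -` A) - E N A\<bar> \<le> 1 / real (n N)"
          unfolding eq using n0[of N] by (auto simp: indicator_def)
        also have "\<dots> \<le> 1 / real (Suc N)" using n[of N] by (intro divide_left_mono) auto
        finally show ?thesis by simp
      qed
      have "(\<lambda>N. E N (shift -` A) - E N A) \<longlonglongrightarrow> 0"
        by (rule Lim_null_comparison[OF _ LIMSEQ_Suc[OF lim_1_over_n]]) (use bnd in auto)
      then show "((\<lambda>N. E N (shift -` A) - E N A) \<longlongrightarrow> 0) G"
        using G(2) by (rule tendsto_mono[rotated])
    qed
    then show "measure (distr \<mu> Omega shift) A = measure \<mu> A"
      using A A' by (subst measure_distr) (auto simp: ms sp \<mu> local_sets_sets_Omega)
  qed (use sets ps in auto)
  have orbit: "(shift ^^ m) y \<in> X" if "y \<in> X" for m y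
    using that X by (induction m) (auto simp: subshift_def)
  \<comment> \<open>A window pattern absent from \<open>X\<close> has frequency 0 along orbits in
    \<open>X\<close>, hence is null. There are countably many patterns, and a configuration all of
    whose windows occur in \<open>X\<close> lies in \<open>X\<close>, since \<open>X\<close> is
    closed.\<close>
  have AE_X: "AE y in \<mu>. y \<in> X"
  proof -
    define F where "F m y = map y [- int m..int m]" for m :: nat and y :: config
    define B where "B m w = {y. F m y = w}" for m w
    have Bloc: "B m w \<in> local_sets" for m w
      by (rule local_setsI[where m = m]) (auto simp: B_def F_def abs_le_iff cong: map_cong)
    have null: "AE y in \<mu>. y \<notin> B m w" if "w \<notin> F m ` X" for m w
    proof -
      have "E N (B m w) = 0" for N
        using that orbit[OF xX[of N]] by (auto simp: E_def B_def indicator_def)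
      then have "q (B m w) = 0" using tendsto_unique[OF G(1) q, of "B m w" 0] by simp
      then have "B m w \<in> null_sets \<mu>"
        using Bloc by (auto simp: null_sets_def emeasure_eq_measure \<mu> sets local_sets_sets_Omega)
      then show ?thesis by (rule AE_not_in)
    qed
    have "AE y in \<mu>. \<forall>m w. w \<notin> F m ` X \<longrightarrow> y \<notin> B m w"
      unfolding AE_all_countable using null by auto
    then show ?thesis
    proof eventually_elim
      case (elim y)
      show "y \<in> X"
      proof (rule ccontr)
        assume "y \<notin> X"
        \<comment> \<open>The points of \<open>X\<close> that agree with \<open>y\<close> on
          [-m, m]: nested nonempty closed sets, whose only possible common point is
          \<open>y\<close>.\<close>
        define C where "C m = X \<inter> B m (F m y)" for m
        have clC: "closed (C m)" for m
          using X closed_local_set[OF Bloc] by (simp add: C_def subshift_def closed_Int)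
        have decC: "C m' \<subseteq> C m" if "m \<le> m'" for m m'
          using that by (auto simp: C_def B_def F_def)
        have neC: "C m \<noteq> {}" for m
        proof -
          have "F m y \<in> F m ` X" using elim by (auto simp: B_def)
          then obtain z where "z \<in> X" "F m y = F m z" by blast
          then have "z \<in> C m" by (simp add: C_def B_def)
          then show ?thesis by blast
        qed
        have "UNIV \<inter> (\<Inter>m\<in>UNIV. C m) \<noteq> {}"
        proof (rule compact_imp_fip_image[OF compact_UNIV_config])
          fix I :: "nat set" assume I: "finite I" "I \<subseteq> UNIV"
          have "C (Max (insert 0 I)) \<subseteq> C i" if "i \<in> I" for i
            using I that by (intro decC) auto
          with neC[of "Max (insert 0 I)"] show "UNIV \<inter> (\<Inter>i\<in>I. C i) \<noteq> {}" by blast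
        qed (rule clC)
        then obtain z where z: "\<And>m. z \<in> C m" by blast
        have "z i = y i" for i
        proof -
          have "\<forall>j\<in>{- \<bar>i\<bar>..\<bar>i\<bar>}. z j = y j"
            using z[of "nat \<bar>i\<bar>"] by (simp add: C_def B_def F_def)
          then show ?thesis by (rule bspec) auto
        qed
        then have "z = y" by auto
        with z[of 0] \<open>y \<notin> X\<close> show False by (simp add: C_def)
      qed
    qed
  qed
  have "\<mu> \<in> Minv X" using sets ps inv AE_X by (simp add: Minv_def)
  note less = h[OF this]
  have sf: "simple_function \<mu> (word k)"
    using simple_function_word[of k] by (simp add: simple_function_eq_measurable ms sp)
  have cyl: "{y \<in> space \<mu>. word k y = w} \<in> local_sets" for w
    using local_sets_Collect_word[of "\<lambda>v. v = w" k 0] by (simp add: sp)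
  have finr: "finite (range (word k))" using simple_functionD(1)[OF sf] by (simp add: sp)
  \<comment> \<open>The integrand depends on one word only, so its integral is a finite combination
    of values of \<open>q\<close> on local sets and passes to the limit along
    \<open>G\<close>.\<close>
  have "(\<integral>y. h (word k y) \<partial>\<mu>) = (\<Sum>w\<in>range (word k). q {y. word k y = w} * h w)"
    using integral_simple[OF sf, of h] cyl by (simp add: law_def sp \<mu>)
  moreover have "((\<lambda>N. \<Sum>w\<in>range (word k). E N {y. word k y = w} * h w) \<longlongrightarrow>
      (\<Sum>w\<in>range (word k). q {y. word k y = w} * h w)) G"
    by (intro tendsto_intros q)
  moreover have "a \<le> (\<Sum>w\<in>range (word k). E N {y. word k y = w} * h w)" for N
  proof -
    have "(\<Sum>w\<in>range (word k). E N {y. word k y = w} * h w)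
      = (\<Sum>w\<in>range (word k). \<Sum>m<n N. indicator {y. word k y = w} ((shift ^^ m) (x N)) * h w) / real (n N)"
      unfolding E_def sum_divide_distrib sum_distrib_right by (intro sum.cong refl) simp
    also have "\<dots> = (\<Sum>m<n N. \<Sum>w\<in>range (word k). if word k ((shift ^^ m) (x N)) = w then h w else 0) / real (n N)"
      by (subst sum.swap) (auto intro!: arg_cong[where f = "\<lambda>s. s / _"] sum.cong simp: indicator_def)
    also have "\<dots> = (\<Sum>m<n N. h (word k ((shift ^^ m) (x N)))) / real (n N)"
      using finr by (simp add: sum.delta)
    also have "a \<le> \<dots>" using big[of N] n0[of N] by (simp add: pos_le_divide_eq mult.commute)
    finally show ?thesis .
  qed
  ultimately have "a \<le> (\<integral>y. h (word k y) \<partial>\<mu>)"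
    using tendsto_lowerbound[OF _ _ G(1)] by (metis (no_types, lifting) always_eventually)
  with less show False by simp
qed

section \<open>Block entropies of invariant measures\<close>

lemma MinvD:
  assumes "\<mu> \<in> Minv Y"
  shows "sets \<mu> = sets Omega" "prob_space \<mu>" "distr \<mu> Omega shift = \<mu>" "space \<mu> = UNIV"
    "\<mu> \<in> Minv UNIV"
  using assms sets_eq_imp_space_eq[of \<mu> Omega] by (auto simp: Minv_def)

lemma Minv2D:
  assumes "L \<in> Minv2"
  shows "sets L = sets (Omega \<Otimes>\<^sub>M Omega)" "prob_space L"
    "distr L (Omega \<Otimes>\<^sub>M Omega) (map_prod shift shift) = L" "space L = UNIV"
  using assms sets_eq_imp_space_eq[of L "Omega \<Otimes>\<^sub>M Omega"]
  by (auto simp: Minv2_def space_pair_measure map_prod_def)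

lemma funpow_measurable:
  assumes f: "f \<in> measurable N N"
  shows "f ^^ m \<in> measurable N N"
  by (induction m) (auto simp: o_def intro: measurable_compose[OF _ f])

lemma distr_funpow:
  assumes sets: "sets M = sets N" and f: "f \<in> measurable N N" and inv: "distr M N f = M"
  shows "distr M N (f ^^ m) = M"
proof (induction m)
  case 0
  show ?case using sets by (simp add: id_def distr_id2)
next
  case (Suc m)
  have fm: "f ^^ m \<in> measurable N N"
    using f by (rule funpow_measurable)
  have "distr M N (f ^^ Suc m) = distr (distr M N f) N (f ^^ m)"
    using f fm by (subst distr_distr) (auto simp: funpow_Suc_right measurable_cong_sets[OF sets refl] simp del: funpow.simps)
  then show ?case by (simp only: inv Suc.IH)
qed

lemma simple_function_sets_cong:
  "sets M = sets N \<Longrightarrow> simple_function N f \<Longrightarrow> simple_function M f"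
  using sets_eq_imp_space_eq[of M N] measurable_cong_sets[of M N "count_space UNIV" "count_space UNIV"]
  unfolding simple_function_eq_measurable by metis

lemma ent_comp_invariant:
  assumes sets: "sets M = sets N" and f: "f \<in> measurable N N" and inv: "distr M N f = M"
    and X: "simple_function N X"
  shows "ent M (\<lambda>\<omega>. X ((f ^^ m) \<omega>)) = ent M X"
proof -
  have fm: "f ^^ m \<in> measurable M N"
    unfolding measurable_cong_sets[OF sets refl] using f by (rule funpow_measurable)
  show ?thesis
    using ent_distr[OF fm X] unfolding distr_funpow[OF sets f inv] ..
qed

text \<open>Together with \<open>ent_cong\<close> this identifies the entropy of a long word with
  that of the pair of its two pieces.\<close>

lemma word_add_eq_iff:
  "word (m + n) x = word (m + n) y \<longleftrightarrow>
    word m x = word m y \<and> word n ((shift ^^ m) x) = word n ((shift ^^ m) y)"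
proof -
  have "word (m + n) x = word m x @ word n ((shift ^^ m) x)" for x
    by (rule nth_equalityI) (auto simp: word_def nth_append shift_pow_apply)
  then show ?thesis by (metis append_eq_append_conv length_word)
qed

lemma block_entropy_eq_ent:
  assumes "\<mu> \<in> Minv UNIV"
  shows "block_entropy \<mu> n = ent \<mu> (word n)"
proof -
  note \<mu> = MinvD[OF assms]
  interpret prob_space \<mu> by fact
  have sf: "simple_function \<mu> (word n)"
    using \<mu>(1) simple_function_word by (rule simple_function_sets_cong)
  have "ent \<mu> (word n) = (\<Sum>w\<in>{w. length w = n}. law \<mu> (word n) w * - log 2 (law \<mu> (word n) w))"
    unfolding ent_def integral_simple[OF sf, of "\<lambda>w. - log 2 (law \<mu> (word n) w)"] \<mu>(4) surj_word ..
  also have "\<dots> = (\<Sum>w\<in>{w. length w = n}. - (measure \<mu> (cyl w) * log 2 (measure \<mu> (cyl w))))"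
    by (intro sum.cong refl) (auto simp: law_def cyl_eq_word \<mu>(4))
  finally show ?thesis by (simp add: block_entropy_def sum_negf)
qed

text \<open>Cutting a word in two and using invariance for the second piece makes the block
  entropies subadditive. Only with convergence does the \<open>lim\<close> in
  \<open>entropy_ms\<close> carry information.\<close>

lemma block_entropy_convergent:
  assumes "\<mu> \<in> Minv UNIV"
  shows "(\<lambda>n. block_entropy \<mu> n / real n) \<longlonglongrightarrow> entropy_ms \<mu>"
proof -
  note \<mu> = MinvD[OF assms]
  interpret prob_space \<mu> by fact
  have sf: "simple_function \<mu> (word n)" for n
    using \<mu>(1) simple_function_word by (rule simple_function_sets_cong)
  have sm: "simple_function \<mu> (\<lambda>x. word n ((shift ^^ m) x))" for m n
    by (rule simple_function_comp_measurable[OF _ simple_function_word])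
      (simp add: measurable_cong_sets[OF \<mu>(1) refl])
  have "convergent (\<lambda>n. ent \<mu> (word n) / real n)"
  proof (rule subadditive_convergent)
    fix m n
    have "ent \<mu> (word (m + n)) = ent \<mu> (\<lambda>x. (word m x, word n ((shift ^^ m) x)))"
      by (rule ent_cong) (simp add: word_add_eq_iff)
    also have "\<dots> \<le> ent \<mu> (word m) + ent \<mu> (\<lambda>x. word n ((shift ^^ m) x))"
      by (intro ent_subadd sf sm)
    also have "ent \<mu> (\<lambda>x. word n ((shift ^^ m) x)) = ent \<mu> (word n)"
      by (rule ent_comp_invariant[OF \<mu>(1) shift_measurable \<mu>(3) simple_function_word])
    finally show "ent \<mu> (word (m + n)) \<le> ent \<mu> (word m) + ent \<mu> (word n)" .
  next
    show "0 \<le> ent \<mu> (word n)" for n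
      unfolding ent_def
    proof (rule integral_nonneg_AE)
      show "AE x in \<mu>. 0 \<le> - log 2 (law \<mu> (word n) (word n x))"
        using AE_law_pos[OF sf[of n]] by eventually_elim (simp add: law_def)
    qed
  qed
  then show ?thesis
    unfolding entropy_ms_def block_entropy_eq_ent[OF assms] by (simp add: convergent_LIMSEQ_iff)
qed

lemma integral_coordinate_invariant:
  fixes f :: "bool \<Rightarrow> real"
  assumes "\<mu> \<in> Minv UNIV"
  shows "(\<integral>x. f (x (int i)) \<partial>\<mu>) = (\<integral>x. f (x 0) \<partial>\<mu>)"
proof -
  note \<mu> = MinvD[OF assms]
  have "(\<integral>x. f (x 0) \<partial>\<mu>) = (\<integral>x. f (x 0) \<partial>(distr \<mu> Omega (shift ^^ i)))"
    by (subst distr_funpow[OF \<mu>(1) shift_measurable \<mu>(3)]) simp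
  also have "\<dots> = (\<integral>x. f ((shift ^^ i) x 0) \<partial>\<mu>)"
    by (rule integral_distr) (auto simp: measurable_cong_sets[OF \<mu>(1) refl])
  finally show ?thesis by (simp add: shift_pow_apply)
qed

text \<open>Words see only nonnegative coordinates. Invariance moves the window [-m, m] to [0, 2 m],
  of length 2 m + 1, where a local set becomes a finite union of word cylinders.\<close>

lemma Minv_cyl_eqI:
  assumes "\<mu> \<in> Minv UNIV" "\<mu>' \<in> Minv UNIV"
    and eq: "\<And>n w. law \<mu> (word n) w = law \<mu>' (word n) w"
  shows "\<mu> = \<mu>'"
proof (rule local_measure_eqI)
  fix A assume "A \<in> local_sets"
  then obtain m where m: "\<And>x y. (\<forall>i. \<bar>i\<bar> \<le> int m \<longrightarrow> x i = y i) \<Longrightarrow> x \<in> A \<longleftrightarrow> y \<in> A"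
    unfolding local_sets_def by blast
  define N where "N = 2 * m + 1"
  define B where "B = (shift ^^ m) -` A"
  have Bw: "x \<in> B \<longleftrightarrow> y \<in> B" if "word N x = word N y" for x y
  proof -
    have eq: "x (int i) = y (int i)" if "i < N" for i
      using arg_cong[OF \<open>word N x = word N y\<close>, of "\<lambda>w. w ! i"] that by (simp add: word_def)
    have "x (i + int m) = y (i + int m)" if "\<bar>i\<bar> \<le> int m" for i
    proof -
      have "0 \<le> i + int m" using that by linarith
      then show ?thesis using eq[of "nat (i + int m)"] that by (simp add: N_def)
    qed
    then show ?thesis unfolding B_def vimage_eq by (intro m) (simp add: shift_pow_apply)
  qed
  have meas: "measure M A = (\<Sum>w\<in>word N ` B. law M (word N) w)" if M: "M \<in> Minv UNIV" for M
  proof -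
    note M = MinvD[OF M]
    interpret prob_space M by fact
    have sf: "simple_function M (word N)"
      using M(1) simple_function_word by (rule simple_function_sets_cong)
    have fin: "finite (word N ` B)"
      using simple_functionD(1)[OF sf] by (rule finite_subset[rotated]) (auto simp: M(4))
    have "measure M A = measure (distr M Omega (shift ^^ m)) A"
      by (subst distr_funpow[OF M(1) shift_measurable M(3)]) simp
    also have "\<dots> = measure M B"
      using \<open>A \<in> local_sets\<close> by (subst measure_distr)
        (auto simp: measurable_cong_sets[OF M(1) refl] local_sets_sets_Omega B_def M(4))
    also have "B = (\<Union>w\<in>word N ` B. {x \<in> space M. word N x = w})"
      using Bw unfolding M(4) by blast
    also have "measure M \<dots> = (\<Sum>w\<in>word N ` B. law M (word N) w)"
      unfolding law_def using fin
      by (intro finite_measure_finite_Union)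
        (auto simp: disjoint_family_on_def intro!: simple_function_level_sets[OF sf])
    finally show ?thesis .
  qed
  show "measure \<mu> A = measure \<mu>' A" using assms(1,2) by (simp add: meas eq)
qed (use assms(1,2) in \<open>auto dest: MinvD\<close>)

section \<open>Couplings over a zero entropy base\<close>

text \<open>The product is recorded in place of the second coordinate, because a symbol of y under a
  0 of x leaves no trace in the image measure.\<close>

definition joint :: "nat \<Rightarrow> config \<times> config \<Rightarrow> bool list \<times> bool list" where
  "joint n \<omega> = (word n (fst \<omega>), word n (Mmap \<omega>))"

lemma simple_function_joint:
  "simple_function (Omega \<Otimes>\<^sub>M Omega) (\<lambda>\<omega>. word n (fst \<omega>))"
  "simple_function (Omega \<Otimes>\<^sub>M Omega) (\<lambda>\<omega>. word n (Mmap \<omega>))"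
  "simple_function (Omega \<Otimes>\<^sub>M Omega) (joint n)"
proof -
  show *: "simple_function (Omega \<Otimes>\<^sub>M Omega) (\<lambda>\<omega>. word n (fst \<omega>))"
    "simple_function (Omega \<Otimes>\<^sub>M Omega) (\<lambda>\<omega>. word n (Mmap \<omega>))"
    by (rule simple_function_comp_measurable[OF _ simple_function_word], simp)+
  show "simple_function (Omega \<Otimes>\<^sub>M Omega) (joint n)"
    unfolding joint_def[abs_def] using * by (rule simple_function_Pair)
qed

lemma Mmap_shift: "Mmap (map_prod shift shift \<omega>) = shift (Mmap \<omega>)"
  by (simp add: Mmap_def shift_def)

lemma map_prod_shift_pow:
  "fst ((map_prod shift shift ^^ m) \<omega>) = (shift ^^ m) (fst \<omega>)"
  "Mmap ((map_prod shift shift ^^ m) \<omega>) = (shift ^^ m) (Mmap \<omega>)"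
  by (induction m) (auto simp: Mmap_shift)

lemma map_prod_shift_measurable:
  "map_prod shift shift \<in> measurable (Omega \<Otimes>\<^sub>M Omega) (Omega \<Otimes>\<^sub>M Omega)"
  unfolding map_prod_def case_prod_beta by measurable

lemma Minv2_distr:
  assumes L: "L \<in> Minv2" and f: "f \<in> measurable (Omega \<Otimes>\<^sub>M Omega) Omega"
    and eq: "\<And>\<omega>. f (map_prod shift shift \<omega>) = shift (f \<omega>)"
  shows "distr L Omega f \<in> Minv UNIV"
proof -
  note LD = Minv2D[OF L]
  have fL: "f \<in> measurable L Omega" using f by (simp add: measurable_cong_sets[OF LD(1) refl])
  have "distr (distr L Omega f) Omega shift = distr L Omega (\<lambda>\<omega>. f (map_prod shift shift \<omega>))"
    by (subst distr_distr[OF shift_measurable fL]) (simp add: o_def eq)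
  also have "\<dots> = distr (distr L (Omega \<Otimes>\<^sub>M Omega) (map_prod shift shift)) Omega f"
    using map_prod_shift_measurable
    by (subst distr_distr[OF f]) (auto simp: o_def measurable_cong_sets[OF LD(1) refl])
  also have "\<dots> = distr L Omega f" by (simp add: LD(3))
  finally show ?thesis
    using prob_space.prob_space_distr[OF LD(2) fL] by (simp add: Minv_def)
qed

lemma bernoulli_shift_facts:
  "sets (bernoulli_shift p) = sets Omega" "prob_space (bernoulli_shift p)"
  "distr (bernoulli_shift p) Omega shift = bernoulli_shift p"
proof -
  show s: "sets (bernoulli_shift p) = sets Omega"
    unfolding bernoulli_shift_def Omega_def by (rule sets_PiM_cong) simp_all
  show "prob_space (bernoulli_shift p)"
    unfolding bernoulli_shift_def by (rule prob_space_PiM) (rule prob_space_measure_pmf)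
  \<comment> \<open>A product of identical factors is unchanged by reindexing along the injection i
    + 1.\<close>
  have "distr (bernoulli_shift p) (bernoulli_shift p) (\<lambda>\<omega>. \<lambda>n\<in>UNIV. \<omega> (n + 1)) = bernoulli_shift p"
    unfolding bernoulli_shift_def
    by (rule distr_PiM_reindex[where f = "\<lambda>i. i + 1"]) (auto intro: prob_space_measure_pmf)
  then show "distr (bernoulli_shift p) Omega shift = bernoulli_shift p"
    using distr_cong[OF refl s, of "bernoulli_shift p" shift shift]
    by (simp add: shift_def[abs_def] restrict_def)
qed

lemma measure_bernoulli_shift_emb:
  assumes "finite J"
  shows "measure (bernoulli_shift p) {y. \<forall>i\<in>J. y i \<in> A i}
    = (\<Prod>i\<in>J. measure (measure_pmf (bernoulli_pmf (1 - p))) (A i))"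
proof -
  interpret product_prob_space "\<lambda>_::int. measure_pmf (bernoulli_pmf (1 - p))" UNIV
    by unfold_locales
  have "prod_emb UNIV (\<lambda>_::int. measure_pmf (bernoulli_pmf (1 - p))) J (Pi\<^sub>E J A) = {y. \<forall>i\<in>J. y i \<in> A i}"
    by (auto simp: prod_emb_def PiE_iff)
  then show ?thesis
    using measure_PiM_emb[of J A] assms by (simp add: bernoulli_shift_def)
qed

text \<open>A subordinate subshift is seen through its invariant measures, the images of couplings
  over \<nu>; the development is therefore about couplings, and \<open>X\<close> appears only in the
  lemmas on the pressure.\<close>

locale zero_entropy_base =
  fixes \<nu> :: "config measure" and \<phi> :: "bool \<Rightarrow> real"
  assumes nu: "\<nu> \<in> Minv UNIV" and zero: "entropy_ms \<nu> = 0"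
begin

section \<open>The product coupling as a Gibbs kernel over the base\<close>

definition p :: real where "p = 2 powr \<phi> False / (2 powr \<phi> False + 2 powr \<phi> True)"

text \<open>\<open>psi a\<close> is the logarithm of the sum of \<open>2 powr \<phi> b\<close> over the symbols \<open>b\<close> that a product with \<open>a\<close>
  can take.\<close>

definition psi :: "bool \<Rightarrow> real" where
  "psi a = (if a then log 2 (2 powr \<phi> False + 2 powr \<phi> True) else \<phi> False)"

definition Lstar :: "(config \<times> config) measure" where "Lstar = \<nu> \<Otimes>\<^sub>M bernoulli_shift p"

definition mustar :: "config measure" where "mustar = distr Lstar Omega Mmap"

text \<open>The claimed pressure as an integral; \<open>max_pressure_eq\<close> recovers the closed
  formula.\<close>

definition max_pressure :: real where "max_pressure = (\<integral>x. psi (x 0) \<partial>\<nu>)"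

definition mean_phi :: "config measure \<Rightarrow> real" where "mean_phi \<mu> = (\<integral>x. \<phi> (x 0) \<partial>\<mu>)"

definition couplings :: "(config \<times> config) measure set" where
  "couplings = {L \<in> Minv2. distr L Omega fst = \<nu>}"

lemma couplingsD:
  assumes "L \<in> couplings"
  shows "L \<in> Minv2" "sets L = sets (Omega \<Otimes>\<^sub>M Omega)" "prob_space L" "space L = UNIV"
    "distr L Omega fst = \<nu>" "fst \<in> measurable L Omega" "Mmap \<in> measurable L Omega"
    "distr L Omega Mmap \<in> Minv UNIV"
proof -
  show L: "L \<in> Minv2" "distr L Omega fst = \<nu>" using assms by (auto simp: couplings_def)
  note LD = Minv2D[OF L(1)]
  show "sets L = sets (Omega \<Otimes>\<^sub>M Omega)" "prob_space L" "space L = UNIV" by (fact LD)+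
  show "fst \<in> measurable L Omega" "Mmap \<in> measurable L Omega"
    unfolding measurable_cong_sets[OF LD(1) refl] by simp_all
  show "distr L Omega Mmap \<in> Minv UNIV"
    by (rule Minv2_distr[OF L(1)]) (auto simp: Mmap_shift)
qed

lemma max_pressure_eq: "max_pressure = sym_prob \<nu> False * \<phi> False + sym_prob \<nu> True * log 2 (2 powr \<phi> False + 2 powr \<phi> True)"
proof -
  note nuD = MinvD[OF nu]
  interpret prob_space \<nu> by fact
  have sf: "simple_function \<nu> (\<lambda>x. x 0)"
    by (simp add: simple_function_eq_measurable measurable_cong_sets[OF nuD(1) refl])
  have "range (\<lambda>x::config. x 0) = {False, True}"
    by (auto simp: image_iff intro: exI[of _ "\<lambda>_. _"])
  then show ?thesis
    using integral_simple[OF sf, of psi] by (simp add: max_pressure_def nuD(4) law_def sym_prob_def psi_def)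
qed

lemma Lstar_coupling: "Lstar \<in> couplings"
proof -
  note nuD = MinvD[OF nu]
  note B = bernoulli_shift_facts[of p]
  interpret N: prob_space \<nu> by fact
  interpret B: prob_space "bernoulli_shift p" by fact
  interpret P: pair_prob_space \<nu> "bernoulli_shift p" ..
  have sets: "sets Lstar = sets (Omega \<Otimes>\<^sub>M Omega)"
    unfolding Lstar_def by (rule sets_pair_measure_cong) (use nuD B in auto)
  have "distr \<nu> Omega shift \<Otimes>\<^sub>M distr (bernoulli_shift p) Omega shift
      = distr (\<nu> \<Otimes>\<^sub>M bernoulli_shift p) (Omega \<Otimes>\<^sub>M Omega) (\<lambda>(x, y). (shift x, shift y))"
    by (rule pair_measure_distr)
      (use B in \<open>auto simp: measurable_cong_sets[OF nuD(1) refl] measurable_cong_sets[OF B(1) refl]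
        intro: B.sigma_finite_measure_axioms\<close>)
  then have inv: "distr Lstar (Omega \<Otimes>\<^sub>M Omega) (\<lambda>(x, y). (shift x, shift y)) = Lstar"
    by (simp add: Lstar_def nuD B)
  have "distr Lstar Omega fst = distr Lstar \<nu> fst"
    by (rule distr_cong) (use nuD in auto)
  also have "\<dots> = \<nu>" unfolding Lstar_def by (rule B.distr_pair_fst)
  finally show ?thesis
    using sets inv P.prob_space_axioms by (simp add: couplings_def Minv2_def Lstar_def)
qed

lemma p_bounds: "0 < p" "p < 1"
  by (simp_all add: p_def add_pos_pos)

text \<open>Given x, the symbols of z are independent. Over a 1 of x, the choice of \<open>p\<close>
  gives z_i the weight 2 to the power \<open>\<phi> (z i) - psi True\<close>; over a 0 the symbol 0
  is forced and the exponent is 0. The formula is evaluated at \<open>joint n \<omega>\<close> since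
  it can fail for pairs of words having a 1 of z over a 0 of x.\<close>

lemma law_Lstar:
  "law Lstar (joint n) (joint n \<omega>)
    = law \<nu> (word n) (word n (fst \<omega>)) * 2 powr (\<Sum>i<n. \<phi> (Mmap \<omega> (int i)) - psi (fst \<omega> (int i)))"
proof -
  note nuD = MinvD[OF nu]
  note B = bernoulli_shift_facts[of p]
  interpret N: prob_space \<nu> by fact
  interpret B: prob_space "bernoulli_shift p" by fact
  define x where "x = fst \<omega>"
  define z where "z = Mmap \<omega>"
  \<comment> \<open>The symbols of y compatible with x and z at site i: one symbol if x_i = 1, both
    if x_i = 0.\<close>
  define A where "A i = {b. (x i \<and> b) = z i}" for i
  define C where "C = {y. \<forall>i\<in>int ` {..<n}. y i \<in> A i}"
  have "joint n \<omega>' = joint n \<omega> \<longleftrightarrow> word n (fst \<omega>') = word n x \<and> snd \<omega>' \<in> C" for \<omega>'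
    by (auto simp: joint_def word_def C_def A_def x_def z_def Mmap_def)
  then have eq: "{\<omega>' \<in> space Lstar. joint n \<omega>' = joint n \<omega>} = {x' \<in> space \<nu>. word n x' = word n x} \<times> C"
    using couplingsD(4)[OF Lstar_coupling] nuD(4) by auto
  have cyl: "{x' \<in> space \<nu>. word n x' = word n x} \<in> sets \<nu>"
    by (rule simple_function_level_sets[OF simple_function_sets_cong[OF nuD(1) simple_function_word]])
  have C: "C \<in> sets (bernoulli_shift p)"
  proof -
    have "C = {y \<in> space Omega. \<forall>i\<in>int ` {..<n}. y i \<in> A i}" by (simp add: C_def)
    also have "\<dots> \<in> sets Omega"
      by (intro sets.sets_Collect_finite_All measurable_sets_Collect[OF coordinate_measurable]) auto
    finally show ?thesis by (simp add: B)
  qed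
  have single: "measure (measure_pmf (bernoulli_pmf (1 - p))) (A i) = 2 powr (\<phi> (z i) - psi (x i))" for i
  proof -
    let ?S = "2 powr \<phi> False + 2 powr \<phi> True"
    have S: "0 < ?S" by (simp add: add_pos_pos)
    have 1: "1 - p = 2 powr \<phi> True / ?S" using S by (simp add: p_def field_simps)
    have z: "z i = (x i \<and> snd \<omega> i)" by (simp add: z_def x_def Mmap_def)
    show ?thesis
    proof (cases "x i")
      case True
      then have "A i = {z i}" by (auto simp: A_def)
      with True p_bounds S 1 show ?thesis
        by (cases "z i") (simp_all add: measure_pmf_single psi_def powr_diff p_def)
    next
      case False
      with z have "A i = UNIV" "\<not> z i" by (auto simp: A_def)
      with False show ?thesis by (simp add: psi_def)
    qed
  qed
  have "measure (bernoulli_shift p) C = (\<Prod>i\<in>int ` {..<n}. 2 powr (\<phi> (z i) - psi (x i)))"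
    unfolding C_def by (subst measure_bernoulli_shift_emb) (simp_all add: single)
  also have "\<dots> = (\<Prod>i<n. 2 powr (\<phi> (z (int i)) - psi (x (int i))))"
    by (subst prod.reindex) simp_all
  also have "\<dots> = 2 powr (\<Sum>i<n. \<phi> (z (int i)) - psi (x (int i)))"
    by (subst powr_sum) simp_all
  finally have mC: "measure (bernoulli_shift p) C = \<dots>" .
  show ?thesis
    unfolding law_def[of Lstar] eq unfolding Lstar_def measure_def[of "\<nu> \<Otimes>\<^sub>M bernoulli_shift p"]
      B.emeasure_pair_measure_Times[OF cyl C] enn2real_mult
    by (simp add: measure_def[symmetric] mC law_def x_def z_def)
qed

lemma coupling_simple:
  assumes "L \<in> couplings"
  shows "simple_function L (\<lambda>\<omega>. word n (fst \<omega>))" "simple_function L (\<lambda>\<omega>. word n (Mmap \<omega>))"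
    "simple_function L (joint n)"
  using simple_function_sets_cong[OF couplingsD(2)[OF assms]] simple_function_joint by blast+

lemma law_coupling:
  assumes L: "L \<in> couplings"
  shows "law L (\<lambda>\<omega>. word n (fst \<omega>)) = law \<nu> (word n)"
  using law_distr[OF couplingsD(6)[OF L] simple_function_word] couplingsD(5)[OF L]
  by (simp add: fun_eq_iff)

text \<open>Every coupling has first marginal \<nu> and the Gibbs weights are positive, so its word
  laws are absolutely continuous with respect to those of \<open>Lstar\<close>.\<close>

lemma AE_law_Lstar_pos:
  assumes L: "L \<in> couplings"
  shows "AE \<omega> in L. 0 < law \<nu> (word n) (word n (fst \<omega>))"
    and "AE \<omega> in L. 0 < law Lstar (joint n) (joint n \<omega>)"
proof -
  interpret prob_space L using couplingsD(3)[OF L] .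
  show "AE \<omega> in L. 0 < law \<nu> (word n) (word n (fst \<omega>))"
    using AE_law_pos[OF coupling_simple(1)[OF L, of n]] by (simp add: law_coupling[OF L])
  then show "AE \<omega> in L. 0 < law Lstar (joint n) (joint n \<omega>)"
    by eventually_elim (simp add: law_Lstar)
qed

lemma integrable_coordinate:
  assumes "prob_space L" "f \<in> measurable L Omega"
  shows "integrable L (\<lambda>\<omega>. (g :: bool \<Rightarrow> real) (f \<omega> i))"
proof -
  interpret prob_space L by fact
  have "simple_function L (\<lambda>\<omega>. f \<omega> i)"
    using measurable_compose[OF assms(2) coordinate_measurable] by (simp add: simple_function_eq_measurable)
  then show ?thesis by (rule integrable_simple)
qed

text \<open>By \<open>law_Lstar\<close> the logarithm splits into the information of the base word
  and a sum of one-site functions. Its integral thus depends on the coupling only through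
  \<open>mean_phi\<close> of the image.\<close>

lemma cross_entropy:
  assumes L: "L \<in> couplings"
  shows "(\<integral>\<omega>. - log 2 (law Lstar (joint n) (joint n \<omega>)) \<partial>L)
    = block_entropy \<nu> n + real n * (max_pressure - mean_phi (distr L Omega Mmap))"
proof -
  note LD = couplingsD[OF L]
  interpret prob_space L by fact
  let ?f = "\<lambda>\<omega>. - log 2 (law \<nu> (word n) (word n (fst \<omega>)))"
  have f: "integrable L ?f"
    by (rule integrable_simple[OF coupling_simple(1)[OF L]])
  note i1 = integrable_coordinate[OF LD(3) LD(6), of psi]
  note i2 = integrable_coordinate[OF LD(3) LD(7), of \<phi>]
  have "(\<integral>\<omega>. - log 2 (law Lstar (joint n) (joint n \<omega>)) \<partial>L)
    = (\<integral>\<omega>. ?f \<omega> + (\<Sum>i<n. psi (fst \<omega> (int i)) - \<phi> (Mmap \<omega> (int i))) \<partial>L)"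
  proof (rule integral_cong_AE)
    show "(\<lambda>\<omega>. - log 2 (law Lstar (joint n) (joint n \<omega>))) \<in> borel_measurable L"
      by (rule borel_measurable_integrable[OF integrable_simple[OF coupling_simple(3)[OF L],
        of "\<lambda>w. - log 2 (law Lstar (joint n) w)"]])
    show "AE \<omega> in L. - log 2 (law Lstar (joint n) (joint n \<omega>))
        = ?f \<omega> + (\<Sum>i<n. psi (fst \<omega> (int i)) - \<phi> (Mmap \<omega> (int i)))"
      using AE_law_Lstar_pos(1)[OF L, of n]
      by eventually_elim (simp add: law_Lstar log_mult_pos sum_subtractf)
  qed (intro borel_measurable_integrable Bochner_Integration.integrable_add f
      Bochner_Integration.integrable_sum Bochner_Integration.integrable_diff i1 i2)
  also have "\<dots> = integral\<^sup>L L ?f + (\<integral>\<omega>. (\<Sum>i<n. psi (fst \<omega> (int i)) - \<phi> (Mmap \<omega> (int i))) \<partial>L)"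
    by (rule Bochner_Integration.integral_add[OF f])
      (intro Bochner_Integration.integrable_sum Bochner_Integration.integrable_diff i1 i2)
  also have "(\<integral>\<omega>. (\<Sum>i<n. psi (fst \<omega> (int i)) - \<phi> (Mmap \<omega> (int i))) \<partial>L)
      = (\<Sum>i<n. (\<integral>\<omega>. psi (fst \<omega> (int i)) \<partial>L) - (\<integral>\<omega>. \<phi> (Mmap \<omega> (int i)) \<partial>L))"
    by (subst Bochner_Integration.integral_sum) (simp_all add: i1 i2)
  also have "integral\<^sup>L L ?f = block_entropy \<nu> n"
    unfolding block_entropy_eq_ent[OF nu] using ent_distr[OF LD(6) simple_function_word, of n]
    by (simp add: LD(5) ent_def law_coupling[OF L])
  finally have *: "(\<integral>\<omega>. - log 2 (law Lstar (joint n) (joint n \<omega>)) \<partial>L) = block_entropy \<nu> n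
      + (\<Sum>i<n. (\<integral>\<omega>. psi (fst \<omega> (int i)) \<partial>L) - (\<integral>\<omega>. \<phi> (Mmap \<omega> (int i)) \<partial>L))" .
  have 1: "(\<integral>\<omega>. psi (fst \<omega> (int i)) \<partial>L) = max_pressure" for i
  proof -
    have "(\<integral>x. psi (x (int i)) \<partial>distr L Omega fst) = (\<integral>\<omega>. psi (fst \<omega> (int i)) \<partial>L)"
      by (rule integral_distr[OF LD(6)]) measurable
    then show ?thesis using integral_coordinate_invariant[OF nu, of psi i] by (simp add: LD(5) max_pressure_def)
  qed
  have 2: "(\<integral>\<omega>. \<phi> (Mmap \<omega> (int i)) \<partial>L) = mean_phi (distr L Omega Mmap)" for i
  proof -
    have "(\<integral>x. \<phi> (x (int i)) \<partial>distr L Omega Mmap) = (\<integral>\<omega>. \<phi> (Mmap \<omega> (int i)) \<partial>L)"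
      by (rule integral_distr[OF LD(7)]) measurable
    then show ?thesis using integral_coordinate_invariant[OF LD(8), of \<phi> i] by (simp add: mean_phi_def)
  qed
  show ?thesis unfolding * 1 2 by simp
qed

text \<open>The defect is the relative entropy of the law of \<open>joint n\<close> under \<open>L\<close> with respect to its law
  under \<open>Lstar\<close>; cf. \<open>cross_entropy\<close>.\<close>

definition defect :: "(config \<times> config) measure \<Rightarrow> nat \<Rightarrow> real" where
  "defect L n = block_entropy \<nu> n + real n * (max_pressure - mean_phi (distr L Omega Mmap)) - ent L (joint n)"

lemma defect_Lstar: "defect Lstar n = 0"
  using cross_entropy[OF Lstar_coupling, of n] by (simp add: defect_def ent_def)

text \<open>Gibbs' inequality with the law under \<open>Lstar\<close> as comparison, and its
  equality case at the attained pairs of words.\<close>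

lemma
  assumes L: "L \<in> couplings"
  shows defect_nonneg: "0 \<le> defect L n"
    and defect_zero: "defect L n = 0 \<Longrightarrow> law L (joint n) (joint n \<omega>) = law Lstar (joint n) (joint n \<omega>)"
proof -
  interpret prob_space L using couplingsD(3)[OF L] .
  interpret S: prob_space Lstar using couplingsD(3)[OF Lstar_coupling] .
  have sp: "space L = UNIV" "space Lstar = UNIV" using couplingsD(4) L Lstar_coupling by auto
  have s1: "(\<Sum>a\<in>joint n ` space L. law Lstar (joint n) a) \<le> 1"
    using S.sum_law[OF coupling_simple(3)[OF Lstar_coupling, of n]] by (simp add: sp)
  show "0 \<le> defect L n"
    using gibbs[OF coupling_simple(3)[OF L] _ s1 AE_law_Lstar_pos(2)[OF L]] cross_entropy[OF L, of n]
    by (simp add: defect_def)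
  assume "defect L n = 0"
  then show "law L (joint n) (joint n \<omega>) = law Lstar (joint n) (joint n \<omega>)"
    using gibbs_eq[OF coupling_simple(3)[OF L] _ s1 AE_law_Lstar_pos(2)[OF L], of "joint n \<omega>"]
      cross_entropy[OF L, of n]
    by (simp add: defect_def sp)
qed

text \<open>Up to a term linear in n, the defect is minus the conditional entropy of z given x,
  which is subadditive by \<open>cond_ent_subadd\<close>. Block entropies of \<nu> alone would give
  an inequality in the wrong direction.\<close>

lemma defect_superadditive:
  assumes L: "L \<in> couplings"
  shows "defect L m + defect L n \<le> defect L (m + n)"
proof -
  note LD = couplingsD[OF L]
  interpret prob_space L by fact
  let ?T = "map_prod shift shift :: config \<times> config \<Rightarrow> config \<times> config"
  let ?U = "\<lambda>n \<omega>. word n (fst \<omega>)" and ?V = "\<lambda>n \<omega>. word n (Mmap \<omega>)"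
  have T: "?T ^^ m \<in> measurable L (Omega \<Otimes>\<^sub>M Omega)"
    unfolding measurable_cong_sets[OF LD(2) refl] by (rule funpow_measurable[OF map_prod_shift_measurable])
  note inv = ent_comp_invariant[OF LD(2) map_prod_shift_measurable Minv2D(3)[OF LD(1)]]
  have U: "ent L (?U n) = block_entropy \<nu> n" for n
    using ent_distr[OF LD(6) simple_function_word, of n]
    by (simp add: LD(5) block_entropy_eq_ent[OF nu])
  have 1: "ent L (\<lambda>\<omega>. ((?U m \<omega>, ?V m \<omega>), (?U n ((?T ^^ m) \<omega>), ?V n ((?T ^^ m) \<omega>)))) = ent L (joint (m + n))"
    by (rule ent_cong) (auto simp: joint_def map_prod_shift_pow word_add_eq_iff)
  have 2: "ent L (\<lambda>\<omega>. (?U m \<omega>, ?U n ((?T ^^ m) \<omega>))) = ent L (?U (m + n))"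
    by (rule ent_cong) (auto simp: map_prod_shift_pow word_add_eq_iff)
  have 3: "ent L (\<lambda>\<omega>. (?U n ((?T ^^ m) \<omega>), ?V n ((?T ^^ m) \<omega>))) = ent L (joint n)"
    using inv[OF simple_function_joint(3), of n m] by (simp add: joint_def)
  have 4: "ent L (\<lambda>\<omega>. ?U n ((?T ^^ m) \<omega>)) = ent L (?U n)"
    by (rule inv[OF simple_function_joint(1)])
  have 5: "ent L (\<lambda>\<omega>. (?U m \<omega>, ?V m \<omega>)) = ent L (joint m)"
    by (simp add: joint_def[abs_def])
  have "ent L (joint (m + n)) + ent L (?U m) + ent L (?U n)
      \<le> ent L (?U (m + n)) + ent L (joint m) + ent L (joint n)"
    using cond_ent_subadd[of "?U m" "\<lambda>\<omega>. ?U n ((?T ^^ m) \<omega>)" "?V m" "\<lambda>\<omega>. ?V n ((?T ^^ m) \<omega>)"]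
      coupling_simple[OF L] simple_function_comp_measurable[OF T simple_function_joint(1)]
      simple_function_comp_measurable[OF T simple_function_joint(2)]
    unfolding 1 2 3 4 5 by blast
  then show ?thesis by (simp add: defect_def U algebra_simps)
qed

section \<open>Free energy of couplings and uniqueness of the maximiser\<close>

lemma block_entropy_distr:
  assumes L: "L \<in> couplings"
  shows "block_entropy (distr L Omega Mmap) n = ent L (\<lambda>\<omega>. word n (Mmap \<omega>))"
  unfolding block_entropy_eq_ent[OF couplingsD(8)[OF L]]
  by (rule ent_distr[OF couplingsD(7)[OF L] simple_function_word])

lemma block_entropy_le:
  assumes L: "L \<in> couplings"
  shows "block_entropy (distr L Omega Mmap) n + defect L n
    \<le> block_entropy \<nu> n + real n * (max_pressure - mean_phi (distr L Omega Mmap))"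
proof -
  interpret prob_space L using couplingsD(3)[OF L] .
  have "ent L (\<lambda>\<omega>. word n (Mmap \<omega>)) \<le> ent L (\<lambda>\<omega>. (word n (Mmap \<omega>), word n (fst \<omega>)))"
    by (rule ent_mono[OF coupling_simple(2,1)[OF L]])
  also have "\<dots> = ent L (joint n)" by (rule ent_cong) (auto simp: joint_def)
  finally show ?thesis by (simp add: block_entropy_distr[OF L] defect_def)
qed

text \<open>Subadditivity bounds the entropy of (x, z) by the sum of those of x and z. Since the
  defect of \<open>Lstar\<close> is 0, the base entropy cancels and no error term is left.\<close>

lemma block_entropy_mustar_ge: "real n * (max_pressure - mean_phi mustar) \<le> block_entropy mustar n"
proof -
  interpret prob_space Lstar using couplingsD(3)[OF Lstar_coupling] .
  have "ent Lstar (joint n) \<le> ent Lstar (\<lambda>\<omega>. word n (fst \<omega>)) + ent Lstar (\<lambda>\<omega>. word n (Mmap \<omega>))"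
    unfolding joint_def[abs_def] by (rule ent_subadd[OF coupling_simple(1,2)[OF Lstar_coupling]])
  moreover have "ent Lstar (\<lambda>\<omega>. word n (fst \<omega>)) = block_entropy \<nu> n"
    using ent_distr[OF couplingsD(6)[OF Lstar_coupling] simple_function_word, of n]
    by (simp add: couplingsD(5)[OF Lstar_coupling] block_entropy_eq_ent[OF nu])
  ultimately show ?thesis
    using defect_Lstar[of n] by (simp add: mustar_def block_entropy_distr[OF Lstar_coupling] defect_def)
qed

lemma block_entropy_nu: "(\<lambda>n. block_entropy \<nu> n / real n) \<longlonglongrightarrow> 0"
  using block_entropy_convergent[OF nu] by (simp add: zero)

lemma mustar_Minv: "mustar \<in> Minv UNIV"
  unfolding mustar_def by (rule couplingsD(8)[OF Lstar_coupling])

text \<open>The lower bound is exact; the upper one has error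
  \<open>block_entropy \<nu> n / n\<close>, which tends to 0 by \<open>zero\<close>.\<close>

lemma entropy_mustar: "entropy_ms mustar + mean_phi mustar = max_pressure"
proof -
  have "(\<lambda>n. block_entropy mustar n / real n) \<longlonglongrightarrow> max_pressure - mean_phi mustar"
  proof (rule tendsto_sandwich)
    show "\<forall>\<^sub>F n in sequentially. max_pressure - mean_phi mustar \<le> block_entropy mustar n / real n"
      using eventually_gt_at_top[of 0]
      by eventually_elim (use block_entropy_mustar_ge in \<open>simp add: pos_le_divide_eq mult.commute\<close>)
    show "\<forall>\<^sub>F n in sequentially. block_entropy mustar n / real n \<le> block_entropy \<nu> n / real n + (max_pressure - mean_phi mustar)"
      using eventually_gt_at_top[of 0]
    proof eventually_elim
      case (elim n)
      have "block_entropy mustar n \<le> block_entropy \<nu> n + real n * (max_pressure - mean_phi mustar)"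
        using block_entropy_le[OF Lstar_coupling, of n] by (simp add: defect_Lstar mustar_def)
      then have "block_entropy mustar n / real n \<le> (block_entropy \<nu> n + real n * (max_pressure - mean_phi mustar)) / real n"
        by (rule divide_right_mono) simp
      with elim show ?case by (simp add: add_divide_distrib)
    qed
    show "(\<lambda>n. block_entropy \<nu> n / real n + (max_pressure - mean_phi mustar)) \<longlonglongrightarrow> max_pressure - mean_phi mustar"
      using tendsto_add[OF block_entropy_nu tendsto_const] by simp
  qed simp
  then have "entropy_ms mustar = max_pressure - mean_phi mustar"
    using LIMSEQ_unique[OF block_entropy_convergent[OF mustar_Minv]] by blast
  then show ?thesis by simp
qed

text \<open>The defect at multiples of k grows at least linearly by superadditivity, while its
  growth rate is at most the gap between \<open>max_pressure\<close> and the free energy. If the gap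
  is 0, every defect vanishes and all laws of (x, z) agree with those under
  \<open>Lstar\<close>.\<close>

lemma equilibrium_unique:
  assumes L: "L \<in> couplings" and eq: "entropy_ms (distr L Omega Mmap) + mean_phi (distr L Omega Mmap) = max_pressure"
  shows "distr L Omega Mmap = mustar"
proof -
  let ?\<mu> = "distr L Omega Mmap"
  note LD = couplingsD[OF L]
  have mult: "real m * defect L k \<le> defect L (m * k)" for m k
  proof (induction m)
    case 0
    show ?case using defect_nonneg[OF L] by simp
  next
    case (Suc m)
    then show ?case using defect_superadditive[OF L, of k "m * k"] by (simp add: algebra_simps)
  qed
  have zero: "defect L k = 0" for k
  proof (cases "k = 0")
    case True
    have "defect L 0 + defect L 0 \<le> defect L 0" using defect_superadditive[OF L, of 0 0] by simp
    with defect_nonneg[OF L, of 0] True show ?thesis by simp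
  next
    case False
    \<comment> \<open>An upper bound for \<open>defect L n / n\<close> by
      \<open>block_entropy_le\<close>; its limit is the free energy gap.\<close>
    let ?r = "\<lambda>n. block_entropy \<nu> n / real n + (max_pressure - mean_phi ?\<mu>) - block_entropy ?\<mu> n / real n"
    have "?r \<longlonglongrightarrow> 0 + (max_pressure - mean_phi ?\<mu>) - entropy_ms ?\<mu>"
      by (intro tendsto_intros block_entropy_nu block_entropy_convergent LD(8))
    then have "?r \<longlonglongrightarrow> 0" using eq by (simp add: algebra_simps)
    then have lim: "(\<lambda>m. ?r (m * k)) \<longlonglongrightarrow> 0"
      by (rule filterlim_compose) (use False in \<open>auto intro!: filterlim_subseq strict_monoI\<close>)
    have "defect L k / real k \<le> 0"
    proof (rule tendsto_lowerbound[OF lim])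
      show "\<forall>\<^sub>F m in sequentially. defect L k / real k \<le> ?r (m * k)"
        using eventually_gt_at_top[of 0]
      proof eventually_elim
        case (elim m)
        define N where "N = m * k"
        have n: "0 < real N" using elim False by (simp add: N_def)
        have "defect L k / real k = real m * defect L k / real N" using elim by (simp add: N_def)
        also have "\<dots> \<le> (block_entropy \<nu> N + real N * (max_pressure - mean_phi ?\<mu>) - block_entropy ?\<mu> N) / real N"
          using mult[of m k, folded N_def] block_entropy_le[OF L, of N] by (intro divide_right_mono) auto
        also have "\<dots> = ?r N" using n by (simp add: add_divide_distrib diff_divide_distrib)
        finally show ?case unfolding N_def .
      qed
    qed simp
    then have "defect L k \<le> 0" using False by (simp add: divide_le_0_iff)
    with defect_nonneg[OF L, of k] show ?thesis by simp
  qed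
  have "law ?\<mu> (word n) w = law mustar (word n) w" for n w
  proof -
    \<comment> \<open>The sum is restricted to pairs attained by \<open>joint\<close>, the only ones
      to which \<open>defect_zero\<close> applies.\<close>
    have marg: "law (distr K Omega Mmap) (word n) w
      = (\<Sum>u\<in>{u. \<exists>\<omega>. joint n \<omega> = (u, w)}. law K (joint n) (u, w))" if K: "K \<in> couplings" for K
    proof -
      note KD = couplingsD[OF K]
      interpret prob_space K by fact
      let ?U = "{u. \<exists>\<omega>. joint n \<omega> = (u, w)}"
      have fin: "finite ?U"
        by (rule finite_subset[OF _ simple_functionD(1)[OF simple_function_word, of n]]) (auto simp: joint_def)
      have "law (distr K Omega Mmap) (word n) w = measure K {\<omega> \<in> space K. word n (Mmap \<omega>) = w}"
        by (subst law_distr[OF KD(7) simple_function_word]) (simp add: law_def)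
      also have "{\<omega> \<in> space K. word n (Mmap \<omega>) = w} = (\<Union>u\<in>?U. {\<omega> \<in> space K. joint n \<omega> = (u, w)})"
      proof (intro equalityI subsetI)
        fix \<omega> assume "\<omega> \<in> {\<omega> \<in> space K. word n (Mmap \<omega>) = w}"
        then have "\<omega> \<in> space K" "joint n \<omega> = (word n (fst \<omega>), w)" by (auto simp: joint_def)
        then show "\<omega> \<in> (\<Union>u\<in>?U. {\<omega> \<in> space K. joint n \<omega> = (u, w)})" by blast
      qed (auto simp: joint_def)
      also have "measure K \<dots> = (\<Sum>u\<in>?U. law K (joint n) (u, w))"
        unfolding law_def using fin
        by (intro finite_measure_finite_Union)
          (auto simp: disjoint_family_on_def intro!: simple_function_level_sets[OF coupling_simple(3)[OF K]])
      finally show ?thesis .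
    qed
    show ?thesis
      unfolding marg[OF L] mustar_def marg[OF Lstar_coupling]
    proof (rule sum.cong[OF refl])
      fix u assume "u \<in> {u. \<exists>\<omega>. joint n \<omega> = (u, w)}"
      then obtain \<omega> where "joint n \<omega> = (u, w)" by blast
      with defect_zero[OF L zero, of n \<omega>] show "law L (joint n) (u, w) = law Lstar (joint n) (u, w)" by simp
    qed
  qed
  then show ?thesis by (intro Minv_cyl_eqI LD(8) mustar_Minv)
qed

end

section \<open>Counting words\<close>

definition partition_sum :: "config set \<Rightarrow> (bool \<Rightarrow> real) \<Rightarrow> nat \<Rightarrow> real" where
  "partition_sum X \<phi> n = (\<Sum>w\<in>lang X n. 2 powr (\<Sum>i<n. \<phi> (w ! i)))"

lemma word_nth: "i < n \<Longrightarrow> word n x ! i = x (int i)"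
  by (simp add: word_def)

lemma sum_word: "(\<Sum>i<n. \<phi> (word n x ! i)) = (\<Sum>i<n. \<phi> (x (int i)))"
  by (intro sum.cong) (auto simp: word_nth)

lemma finite_words: "finite {w :: bool list. length w = n}"
  using finite_lists_length_eq[of "UNIV :: bool set" n] by simp

lemma card_words: "card {w :: bool list. length w = n} = 2 ^ n"
  using card_lists_length_eq[of "UNIV :: bool set" n] by simp

lemma lang_subset: "lang X n \<subseteq> {w. length w = n}"
  by (auto simp: lang_def)

lemma finite_lang: "finite (lang X n)"
  using lang_subset finite_words by (rule finite_subset)

text \<open>The potential depends on one symbol, so Birkhoff sums are constant on a word cylinder
  and each supremum is over a singleton.\<close>

lemma partition_sum_eq:
  "(\<Sum>w\<in>lang X n. 2 powr (SUP x\<in>X \<inter> cyl w. birkhoff_sum (\<lambda>x. \<phi> (x 0)) n x)) = partition_sum X \<phi> n"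
  unfolding partition_sum_def
proof (intro sum.cong refl arg_cong[where f = "\<lambda>s. 2 powr s"])
  fix w assume "w \<in> lang X n"
  then obtain x where x: "x \<in> X" "w = word n x" by (auto simp: lang_def)
  have "birkhoff_sum (\<lambda>x. \<phi> (x 0)) n y = (\<Sum>i<n. \<phi> (w ! i))" if "y \<in> X \<inter> cyl w" for y
    using that x by (auto simp: birkhoff_sum_def shift_pow_apply cyl_def intro!: sum.cong)
  moreover have "X \<inter> cyl w \<noteq> {}" using x by (auto simp: cyl_eq_word)
  ultimately have "birkhoff_sum (\<lambda>x. \<phi> (x 0)) n ` (X \<inter> cyl w) = {\<Sum>i<n. \<phi> (w ! i)}"
    by (auto simp: image_iff)
  then show "(SUP x\<in>X \<inter> cyl w. birkhoff_sum (\<lambda>x. \<phi> (x 0)) n x) = (\<Sum>i<n. \<phi> (w ! i))"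
    by simp
qed

lemma sum_words_append:
  fixes f g :: "bool list \<Rightarrow> real"
  shows "(\<Sum>w\<in>{w. length w = a + b}. f (take a w) * g (drop a w))
    = (\<Sum>u\<in>{w. length w = a}. f u) * (\<Sum>v\<in>{w. length w = b}. g v)"
proof -
  have "(\<Sum>w\<in>{w. length w = a + b}. f (take a w) * g (drop a w))
      = (\<Sum>(u, v)\<in>{w. length w = a} \<times> {w. length w = b}. f u * g v)"
    by (rule sum.reindex_bij_witness[where j = "\<lambda>w. (take a w, drop a w)" and i = "\<lambda>(u, v). u @ v"]) auto
  then show ?thesis by (simp add: sum_product sum.cartesian_product)
qed

text \<open>The first \<open>r\<close> blocks of length \<open>k\<close> are weighted independently
  by \<open>q\<close>; whatever follows them is left unweighted.\<close>

primrec block_prod :: "nat \<Rightarrow> (bool list \<Rightarrow> real) \<Rightarrow> nat \<Rightarrow> bool list \<Rightarrow> real" where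
  "block_prod k q 0 w = 1"
| "block_prod k q (Suc r) w = q (take k w) * block_prod k q r (drop k w)"

lemma take_word: "k \<le> m \<Longrightarrow> take k (word m x) = word k x"
  by (rule nth_equalityI) (auto simp: word_nth)

lemma drop_word: "drop k (word m x) = word (m - k) ((shift ^^ k) x)"
  by (rule nth_equalityI) (auto simp: word_nth shift_pow_apply add.commute)

lemma block_prod_word:
  "r * k \<le> m \<Longrightarrow> block_prod k q r (word m x) = (\<Prod>i<r. q (word k ((shift ^^ (i * k)) x)))"
proof (induction r arbitrary: m x)
  case (Suc r)
  have "block_prod k q (Suc r) (word m x) = q (word k x) * (\<Prod>i<r. q (word k ((shift ^^ (i * k)) ((shift ^^ k) x))))"
    using Suc.prems by (simp add: take_word drop_word Suc.IH)
  also have "\<dots> = (\<Prod>i<Suc r. q (word k ((shift ^^ (i * k)) x)))"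
  proof -
    have "(shift ^^ (i * k)) ((shift ^^ k) x) = (shift ^^ (Suc i * k)) x" for i
      by (simp add: fun_eq_iff shift_pow_apply algebra_simps)
    then show ?thesis unfolding prod.lessThan_Suc_shift by simp
  qed
  finally show ?case .
qed simp

lemma block_prod_nonneg: "(\<And>v. 0 \<le> q v) \<Longrightarrow> 0 \<le> block_prod k q r w"
  by (induction r arbitrary: w) auto

text \<open>Each weighted block contributes a factor at most 1 and each of the \<open>l\<close> free
  symbols a factor 2.\<close>

lemma sum_block_prod_le:
  assumes q: "\<And>v. 0 \<le> q v" "(\<Sum>v\<in>{v. length v = k}. q v) \<le> 1"
  shows "(\<Sum>w\<in>{w. length w = r * k + l}. block_prod k q r w) \<le> 2 ^ l"
proof (induction r)
  case 0
  then show ?case by (simp add: card_words)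
next
  case (Suc r)
  have "(\<Sum>w\<in>{w. length w = Suc r * k + l}. block_prod k q (Suc r) w)
      = (\<Sum>v\<in>{v. length v = k}. q v) * (\<Sum>w\<in>{w. length w = r * k + l}. block_prod k q r w)"
    using sum_words_append[of q k "block_prod k q r" "r * k + l"] by (simp add: add.assoc)
  also have "\<dots> \<le> 1 * 2 ^ l"
    by (intro mult_mono q Suc.IH) (auto intro!: sum_nonneg block_prod_nonneg q)
  finally show ?case by simp
qed

section \<open>Cutting orbit segments into blocks at an offset\<close>

lemma sum_lessThan_add_split:
  fixes g :: "nat \<Rightarrow> real"
  shows "(\<Sum>i<a + b. g i) = (\<Sum>i<a. g i) + (\<Sum>i<b. g (a + i))"
  by (induction b) auto

lemma sum_lessThan_mult:
  fixes g :: "nat \<Rightarrow> real"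
  shows "(\<Sum>m<r * k. g m) = (\<Sum>i<r. \<Sum>l<k. g (i * k + l))"
proof (induction r)
  case (Suc r)
  then show ?case using sum_lessThan_add_split[of g "r * k" k] by (simp add: add.commute)
qed simp

text \<open>Three errors of at most \<open>k\<close> terms each: the tail beyond r k, the
  \<open>j\<close> terms lost at the start and the \<open>j\<close> terms gained at the end.\<close>

lemma sum_offset_le:
  fixes g :: "nat \<Rightarrow> real"
  assumes g: "\<And>i. \<bar>g i\<bar> \<le> C" and n: "r * k \<le> n" "n \<le> r * k + k" and j: "j \<le> k"
  shows "(\<Sum>i<n. g i) \<le> (\<Sum>i<r * k. g (j + i)) + 3 * real k * C"
proof -
  have C: "0 \<le> C" using g[of 0] by linarith
  have bound: "\<bar>\<Sum>i\<in>A. g (f i)\<bar> \<le> real (card A) * C" for A :: "nat set" and f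
    using order_trans[OF sum_abs sum_mono, of A "\<lambda>i. g (f i)" "\<lambda>_. C"] g by simp
  have "(\<Sum>i<n. g i) = (\<Sum>i<r * k. g i) + (\<Sum>i<n - r * k. g (r * k + i))"
    using sum_lessThan_add_split[of g "r * k" "n - r * k"] n by simp
  moreover have "(\<Sum>i<n - r * k. g (r * k + i)) \<le> real k * C"
  proof -
    have "(\<Sum>i<n - r * k. g (r * k + i)) \<le> real (n - r * k) * C"
      using bound[of "\<lambda>i. r * k + i" "{..<n - r * k}"] by simp
    also have "n - r * k \<le> k" using n by simp
    then have "real (n - r * k) * C \<le> real k * C" using C by (intro mult_right_mono) auto
    finally show ?thesis .
  qed
  moreover have "(\<Sum>i<j. g i) + (\<Sum>i<r * k. g (j + i)) = (\<Sum>i<r * k. g i) + (\<Sum>i<j. g (r * k + i))"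
    using sum_lessThan_add_split[of g j "r * k"] sum_lessThan_add_split[of g "r * k" j] by (simp add: add.commute)
  moreover have "real j * C \<le> real k * C" using j C by (intro mult_right_mono) auto
  moreover have "\<bar>\<Sum>i<j. g i\<bar> \<le> real j * C" "\<bar>\<Sum>i<j. g (r * k + i)\<bar> \<le> real j * C"
    using bound[of "\<lambda>i. i" "{..<j}"] bound[of "\<lambda>i. r * k + i" "{..<j}"] by simp_all
  ultimately show ?thesis by linarith
qed

text \<open>Among the \<open>k\<close> ways of cutting an orbit segment into blocks of length \<open>k\<close>, some offset does at least
  as well as the average over all positions; for a fixed offset the weights of all words sum to at
  most 1, up to a bounded number of free symbols at the two ends.\<close>

lemma partition_sum_bound:
  assumes X: "subshift X" and k: "0 < k"
    and q: "\<And>v. 0 < q v" "(\<Sum>v\<in>{v. length v = k}. q v) \<le> 1"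
    and N: "\<And>n x. n \<ge> N \<Longrightarrow> x \<in> X \<Longrightarrow>
      (\<Sum>m<n. - log 2 (q (word k ((shift ^^ m) x))) + (\<Sum>i<k. \<phi> (word k ((shift ^^ m) x) ! i)))
        \<le> real n * (real k * a)"
  shows "\<exists>D. \<forall>n\<ge>N + k. log 2 (partition_sum X \<phi> n) \<le> real n * a + D"
proof -
  define C where "C = max \<bar>\<phi> False\<bar> \<bar>\<phi> True\<bar>"
  have C: "\<bar>\<phi> b\<bar> \<le> C" for b by (cases b) (auto simp: C_def)
  \<comment> \<open>The summands pay for moving the window, for replacing r k by n, and for the
    choice of offset together with the free symbols.\<close>
  define D where "D = 3 * real k * C + real k * \<bar>a\<bar> + log 2 (real k * 2 ^ (3 * k))"
  have "log 2 (partition_sum X \<phi> n) \<le> real n * a + D" if n: "n \<ge> N + k" for n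
  proof -
    define r where "r = n div k"
    have "n mod k < k" using k by simp
    moreover have rn: "n = r * k + n mod k" by (simp add: r_def)
    ultimately have r: "r * k \<le> n" "n \<le> r * k + k" "N \<le> r * k" using n by linarith+
    \<comment> \<open>Summing over all offsets replaces a choice that would depend on the word.
      Lengthening the word to n + 2 k below leaves room for \<open>r\<close> blocks after any
      offset.\<close>
    define G where "G w = (\<Sum>j<k. block_prod k q r (drop j w))" for w
    have G0: "0 \<le> G w" for w
      unfolding G_def by (intro sum_nonneg block_prod_nonneg) (auto intro: less_imp_le q)
    define E where "E = 2 powr (3 * real k * C + real r * (real k * a))"
    have word_le: "2 powr (\<Sum>i<n. \<phi> (x (int i))) \<le> E * G (word (n + 2 * k) x)" if x: "x \<in> X" for x
    proof -
      define h where "h m = - log 2 (q (word k ((shift ^^ m) x))) + (\<Sum>i<k. \<phi> (x (int (m + i))))" for m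
      have "(\<Sum>m<r * k. h m) \<le> real (r * k) * (real k * a)"
        using N[OF r(3) x] by (simp add: h_def sum_word shift_pow_apply add.commute)
      also have "(\<Sum>m<r * k. h m) = (\<Sum>i<r. \<Sum>j<k. h (j + i * k))"
        by (simp add: sum_lessThan_mult add.commute)
      also have "\<dots> = (\<Sum>j<k. \<Sum>i<r. h (j + i * k))" by (rule sum.swap)
      finally have "(\<Sum>j<k. \<Sum>i<r. h (j + i * k)) \<le> (\<Sum>j<k. real r * (real k * a))"
        by (simp add: mult_ac)
      \<comment> \<open>Positions are grouped by their residue modulo \<open>k\<close>; not all
        \<open>k\<close> groups can exceed the average bound.\<close>
      then have "\<not> (\<forall>j\<in>{..<k}. real r * (real k * a) < (\<Sum>i<r. h (j + i * k)))"
        using k sum_strict_mono[of "{..<k}" "\<lambda>j. real r * (real k * a)" "\<lambda>j. \<Sum>i<r. h (j + i * k)"]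
        by (auto simp: not_less[symmetric] simp del: sum_constant)
      then obtain j where j: "j < k" and hj: "(\<Sum>i<r. h (j + i * k)) \<le> real r * (real k * a)"
        by (auto simp: not_less)
      have "(\<Sum>i<r. \<Sum>l<k. \<phi> (x (int (j + i * k + l)))) = (\<Sum>i<r * k. \<phi> (x (int (j + i))))"
        by (simp add: sum_lessThan_mult add.assoc)
      then have phi: "(\<Sum>i<r * k. \<phi> (x (int (j + i)))) =
          (\<Sum>i<r. h (j + i * k)) + (\<Sum>i<r. log 2 (q (word k ((shift ^^ (j + i * k)) x))))"
        by (simp add: h_def sum_subtractf)
      have "(\<Sum>i<n. \<phi> (x (int i))) \<le> (\<Sum>i<r * k. \<phi> (x (int (j + i)))) + 3 * real k * C"
        by (rule sum_offset_le) (use C r j in auto)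
      also have "\<dots> \<le> real r * (real k * a) + 3 * real k * C
          + (\<Sum>i<r. log 2 (q (word k ((shift ^^ (j + i * k)) x))))"
        using hj unfolding phi by simp
      finally have "2 powr (\<Sum>i<n. \<phi> (x (int i))) \<le> E *
          2 powr (\<Sum>i<r. log 2 (q (word k ((shift ^^ (j + i * k)) x))))"
        unfolding E_def by (simp add: powr_add[symmetric] add.commute add.left_commute)
      also have "2 powr (\<Sum>i<r. log 2 (q (word k ((shift ^^ (j + i * k)) x))))
          = (\<Prod>i<r. q (word k ((shift ^^ (j + i * k)) x)))"
        using q(1) by (simp add: powr_sum)
      also have "\<dots> = block_prod k q r (drop j (word (n + 2 * k) x))"
      proof -
        have "(shift ^^ (i * k)) ((shift ^^ j) x) = (shift ^^ (j + i * k)) x" for i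
          by (simp add: fun_eq_iff shift_pow_apply algebra_simps)
        then show ?thesis using r j by (simp add: drop_word block_prod_word)
      qed
      also have "\<dots> \<le> G (word (n + 2 * k) x)"
        unfolding G_def using j
        by (intro member_le_sum[of j "{..<k}" "\<lambda>j. block_prod k q r (drop j (word (n + 2 * k) x))"])
          (auto intro!: block_prod_nonneg less_imp_le[OF q(1)])
      finally show ?thesis by (simp add: E_def)
    qed
    have "\<forall>w\<in>lang X n. \<exists>x. x \<in> X \<and> w = word n x" by (auto simp: lang_def)
    then obtain X' where X': "\<And>w. w \<in> lang X n \<Longrightarrow> X' w \<in> X" "\<And>w. w \<in> lang X n \<Longrightarrow> w = word n (X' w)"
      by metis
    \<comment> \<open>Each word is prolonged along a chosen point of \<open>X\<close>; its prefix of
      length \<open>n\<close> recovers it, so prolongation is injective.\<close>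
    define F where "F w = word (n + 2 * k) (X' w)" for w
    have inj: "inj_on F (lang X n)"
    proof (rule inj_onI)
      fix v w assume vw: "v \<in> lang X n" "w \<in> lang X n" "F v = F w"
      then have "take n (F v) = take n (F w)" by simp
      then show "v = w" using X'(2)[OF vw(1)] X'(2)[OF vw(2)] by (simp add: F_def take_word)
    qed
    have "partition_sum X \<phi> n \<le> (\<Sum>w\<in>lang X n. E * G (F w))"
      unfolding partition_sum_def
    proof (rule sum_mono)
      fix w assume w: "w \<in> lang X n"
      have "(\<Sum>i<n. \<phi> (w ! i)) = (\<Sum>i<n. \<phi> (X' w (int i)))"
        using X'(2)[OF w] sum_word[of \<phi> n "X' w"] by simp
      with word_le[OF X'(1)[OF w]] show "2 powr (\<Sum>i<n. \<phi> (w ! i)) \<le> E * G (F w)"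
        by (simp add: F_def)
    qed
    also have "\<dots> = E * (\<Sum>w\<in>F ` lang X n. G w)"
      by (simp add: sum.reindex[OF inj] sum_distrib_left)
    also have "\<dots> \<le> E * (\<Sum>w\<in>{w. length w = n + 2 * k}. G w)"
      by (intro mult_left_mono sum_mono2 finite_words) (auto simp: F_def E_def G0)
    also have "(\<Sum>w\<in>{w. length w = n + 2 * k}. G w)
        = (\<Sum>j<k. \<Sum>w\<in>{w. length w = n + 2 * k}. block_prod k q r (drop j w))"
      unfolding G_def by (rule sum.swap)
    also have "\<dots> \<le> (\<Sum>j<k. 2 ^ (3 * k))"
    proof (rule sum_mono)
      fix j assume "j \<in> {..<k}"
      then have j: "j < k" by simp
      \<comment> \<open>\<open>j\<close> symbols before the blocks and \<open>l\<close> after them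
        are free, at most 3 k in total.\<close>
      define l where "l = n + 2 * k - j - r * k"
      have l: "n + 2 * k = j + (r * k + l)" "j + l \<le> 3 * k" using j r by (auto simp: l_def)
      have "(\<Sum>w\<in>{w. length w = n + 2 * k}. block_prod k q r (drop j w))
          = 2 ^ j * (\<Sum>w\<in>{w. length w = r * k + l}. block_prod k q r w)"
        using sum_words_append[of "\<lambda>_. 1" j "block_prod k q r" "r * k + l"] by (simp add: l card_words)
      also have "\<dots> \<le> 2 ^ j * 2 ^ l"
        by (intro mult_left_mono sum_block_prod_le q less_imp_le[OF q(1)]) simp
      also have "\<dots> \<le> 2 ^ (3 * k)" using l(2) by (simp add: power_add[symmetric] power_increasing)
      finally show "(\<Sum>w\<in>{w. length w = n + 2 * k}. block_prod k q r (drop j w)) \<le> 2 ^ (3 * k)" .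
    qed
    also have "(\<Sum>j<k. 2 ^ (3 * k)) = real k * 2 ^ (3 * k)" by simp
    finally have Z: "partition_sum X \<phi> n \<le> E * (real k * 2 ^ (3 * k))" by (simp add: E_def)
    have "X \<noteq> {}" using X by (simp add: subshift_def)
    then have "lang X n \<noteq> {}" by (simp add: lang_def)
    then have "0 < partition_sum X \<phi> n"
      unfolding partition_sum_def by (intro sum_pos finite_lang) simp_all
    with Z have "log 2 (partition_sum X \<phi> n) \<le> log 2 (E * (real k * 2 ^ (3 * k)))" by simp
    also have "\<dots> = 3 * real k * C + real r * (real k * a) + log 2 (real k * 2 ^ (3 * k))"
      using k by (subst log_mult_pos) (auto simp: E_def)
    also have "real r * (real k * a) = real n * a - real (n mod k) * a"
      using arg_cong[OF rn, of real] by (simp add: algebra_simps)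
    also have "real n * a - real (n mod k) * a \<le> real n * a + real k * \<bar>a\<bar>"
    proof -
      have "\<bar>real (n mod k) * a\<bar> \<le> real k * \<bar>a\<bar>"
        unfolding abs_mult using k by (intro mult_right_mono) (auto intro: less_imp_le)
      then show ?thesis by linarith
    qed
    finally show ?thesis by (simp add: D_def)
  qed
  then show ?thesis by blast
qed

section \<open>Pressure and equilibrium states\<close>

lemma partition_sum_pos:
  assumes "X \<noteq> {}" shows "0 < partition_sum X \<phi> n"
  unfolding partition_sum_def using assms by (intro sum_pos finite_lang) (auto simp: lang_def)

context zero_entropy_base
begin

section \<open>Variational bounds for the partition sums\<close>

lemma integral_word_sum:
  assumes "\<mu> \<in> Minv UNIV"
  shows "integrable \<mu> (\<lambda>x. \<Sum>i<n. \<phi> (x (int i)))"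
    "(\<integral>x. (\<Sum>i<n. \<phi> (x (int i))) \<partial>\<mu>) = real n * mean_phi \<mu>"
proof -
  note D = MinvD[OF assms]
  have i: "integrable \<mu> (\<lambda>x. \<phi> (x i))" for i
    using integrable_coordinate[OF D(2), of "\<lambda>x. x"] by (simp add: measurable_cong_sets[OF D(1) refl])
  then show "integrable \<mu> (\<lambda>x. \<Sum>i<n. \<phi> (x (int i)))" by simp
  have "(\<integral>x. (\<Sum>i<n. \<phi> (x (int i))) \<partial>\<mu>) = (\<Sum>i<n. \<integral>x. \<phi> (x (int i)) \<partial>\<mu>)"
    by (rule Bochner_Integration.integral_sum) (rule i)
  then show "(\<integral>x. (\<Sum>i<n. \<phi> (x (int i))) \<partial>\<mu>) = real n * mean_phi \<mu>"
    using integral_coordinate_invariant[OF assms, of \<phi>] by (simp add: mean_phi_def)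
qed

text \<open>The easy half of the variational principle at finite n: Gibbs' inequality against the
  normalised weights of the words of \<open>X\<close>, which carry all the mass.\<close>

lemma block_entropy_le_partition_sum:
  assumes \<mu>: "\<mu> \<in> Minv X" and X: "X \<noteq> {}"
  shows "block_entropy \<mu> n + real n * mean_phi \<mu> \<le> log 2 (partition_sum X \<phi> n)"
proof -
  note D = MinvD[OF \<mu>]
  interpret prob_space \<mu> by fact
  let ?Z = "partition_sum X \<phi> n"
  have Z: "0 < ?Z" using X by (rule partition_sum_pos)
  define g where "g w = (if w \<in> lang X n then 2 powr (\<Sum>i<n. \<phi> (w ! i)) / ?Z else 0)" for w
  have sf: "simple_function \<mu> (word n)"
    using D(1) simple_function_word by (rule simple_function_sets_cong)
  have sub: "lang X n \<subseteq> word n ` space \<mu>" by (auto simp: lang_def D(4))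
  have "(\<Sum>w\<in>word n ` space \<mu>. g w) = (\<Sum>w\<in>lang X n. g w)"
    using simple_functionD(1)[OF sf] sub by (intro sum.mono_neutral_right) (auto simp: g_def)
  also have "\<dots> = 1"
    using Z by (simp add: g_def partition_sum_def sum_divide_distrib[symmetric])
  finally have g1: "(\<Sum>w\<in>word n ` space \<mu>. g w) \<le> 1" by simp
  have AE_X: "AE x in \<mu>. x \<in> X" using \<mu> by (simp add: Minv_def)
  have logg: "log 2 (g (word n x)) = (\<Sum>i<n. \<phi> (x (int i))) - log 2 ?Z" if "x \<in> X" for x
  proof -
    have "word n x \<in> lang X n" using that by (simp add: lang_def)
    then show ?thesis using Z by (simp add: g_def log_divide_pos sum_word)
  qed
  have pos: "AE x in \<mu>. 0 < g (word n x)"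
    using AE_X by eventually_elim (use Z in \<open>auto simp: g_def lang_def\<close>)
  have "block_entropy \<mu> n \<le> (\<integral>x. - log 2 (g (word n x)) \<partial>\<mu>)"
    unfolding block_entropy_eq_ent[OF D(5)]
    by (rule gibbs[OF sf _ g1 pos]) (use Z in \<open>auto simp: g_def\<close>)
  also have "\<dots> = (\<integral>x. log 2 ?Z - (\<Sum>i<n. \<phi> (x (int i))) \<partial>\<mu>)"
  proof (rule integral_cong_AE)
    show "(\<lambda>x. - log 2 (g (word n x))) \<in> borel_measurable \<mu>"
      by (rule borel_measurable_integrable[OF integrable_simple[OF sf, of "\<lambda>w. - log 2 (g w)"]])
    show "(\<lambda>x. log 2 ?Z - (\<Sum>i<n. \<phi> (x (int i)))) \<in> borel_measurable \<mu>"
      using borel_measurable_integrable[OF integral_word_sum(1)[OF D(5), of n]] by simp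
    show "AE x in \<mu>. - log 2 (g (word n x)) = log 2 ?Z - (\<Sum>i<n. \<phi> (x (int i)))"
      using AE_X by eventually_elim (simp add: logg)
  qed
  also have "\<dots> = log 2 ?Z - real n * mean_phi \<mu>"
    using integral_word_sum[OF D(5), of n] by (simp add: prob_space)
  finally show ?thesis by simp
qed

text \<open>The mixture with the uniform distribution keeps the logarithm finite on all words.\<close>

definition smooth :: "nat \<Rightarrow> bool list \<Rightarrow> real" where
  "smooth k v = (law mustar (word k) v + (1/2) ^ k) / 2"

lemma smooth_pos: "0 < smooth k v"
  by (simp add: smooth_def add_nonneg_pos)

lemma sum_smooth: "(\<Sum>v\<in>{v. length v = k}. smooth k v) \<le> 1"
proof -
  note D = MinvD[OF mustar_Minv]
  interpret prob_space mustar by fact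
  have sf: "simple_function mustar (word k)"
    using D(1) simple_function_word by (rule simple_function_sets_cong)
  have "(\<Sum>v\<in>{v. length v = k}. law mustar (word k) v) = 1"
    using sum_law[OF sf] by (simp add: D(4) surj_word)
  then show ?thesis
    by (simp add: smooth_def sum_divide_distrib[symmetric] sum.distrib card_words power_mult_distrib[symmetric])
qed

text \<open>Forgetting x can only increase the mass; the factor 1/2 is the share of
  \<open>mustar\<close> in the mixture.\<close>

lemma law_Lstar_le_smooth: "law Lstar (joint k) (joint k \<omega>) / 2 \<le> smooth k (word k (Mmap \<omega>))"
proof -
  note D = couplingsD[OF Lstar_coupling]
  interpret prob_space Lstar by fact
  have "law Lstar (joint k) (joint k \<omega>) \<le> law Lstar (\<lambda>\<omega>. word k (Mmap \<omega>)) (word k (Mmap \<omega>))"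
    unfolding law_def
    by (rule finite_measure_mono)
      (auto simp: joint_def intro!: simple_function_level_sets coupling_simple(2)[OF Lstar_coupling])
  also have "\<dots> = law mustar (word k) (word k (Mmap \<omega>))"
    unfolding mustar_def by (rule law_distr[OF D(7) simple_function_word, symmetric])
  finally show ?thesis by (simp add: smooth_def add_increasing2)
qed

text \<open>By \<open>law_Lstar_le_smooth\<close> the cross entropy against \<open>smooth\<close>
  exceeds that against the law of \<open>joint k\<close> under \<open>Lstar\<close> by at most one
  bit. In \<open>cross_entropy\<close> the mean of \<phi> then cancels, so the bound is uniform over
  couplings.\<close>

lemma integral_smooth_le:
  assumes L: "L \<in> couplings"
  shows "(\<integral>x. - log 2 (smooth k (word k x)) + (\<Sum>i<k. \<phi> (word k x ! i)) \<partial>distr L Omega Mmap)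
    \<le> 1 + block_entropy \<nu> k + real k * max_pressure"
proof -
  note LD = couplingsD[OF L]
  interpret prob_space L by fact
  let ?\<mu> = "distr L Omega Mmap"
  interpret M: prob_space ?\<mu> using MinvD(2)[OF LD(8)] .
  have sf: "simple_function ?\<mu> (word k)"
    by (rule simple_function_sets_cong[OF _ simple_function_word]) simp
  have "(\<integral>x. - log 2 (smooth k (word k x)) \<partial>?\<mu>) = (\<integral>\<omega>. - log 2 (smooth k (word k (Mmap \<omega>))) \<partial>L)"
    by (rule integral_distr[OF LD(7)])
      (use borel_measurable_integrable[OF M.integrable_simple[OF sf, of "\<lambda>v. - log 2 (smooth k v)"]] in simp)
  also have "\<dots> \<le> (\<integral>\<omega>. 1 + - log 2 (law Lstar (joint k) (joint k \<omega>)) \<partial>L)"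
  proof (rule integral_mono_AE)
    show "integrable L (\<lambda>\<omega>. - log 2 (smooth k (word k (Mmap \<omega>))))"
      by (rule integrable_simple[OF coupling_simple(2)[OF L]])
    show "integrable L (\<lambda>\<omega>. 1 + - log 2 (law Lstar (joint k) (joint k \<omega>)))"
      by (rule integrable_simple[OF coupling_simple(3)[OF L], of "\<lambda>w. 1 + - log 2 (law Lstar (joint k) w)"])
    show "AE \<omega> in L. - log 2 (smooth k (word k (Mmap \<omega>))) \<le> 1 + - log 2 (law Lstar (joint k) (joint k \<omega>))"
      using AE_law_Lstar_pos(2)[OF L, of k]
    proof eventually_elim
      case (elim \<omega>)
      then have "log 2 (law Lstar (joint k) (joint k \<omega>) / 2) \<le> log 2 (smooth k (word k (Mmap \<omega>)))"
        using law_Lstar_le_smooth[of k \<omega>] smooth_pos by simp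
      with elim show ?case by (simp add: log_divide_pos)
    qed
  qed
  also have "\<dots> = 1 + (block_entropy \<nu> k + real k * (max_pressure - mean_phi ?\<mu>))"
    unfolding cross_entropy[OF L, symmetric]
    using integrable_simple[OF coupling_simple(3)[OF L], of "\<lambda>w. - log 2 (law Lstar (joint k) w)"]
    by (subst Bochner_Integration.integral_add) (simp_all add: prob_space)
  finally have "(\<integral>x. - log 2 (smooth k (word k x)) \<partial>?\<mu>) + real k * mean_phi ?\<mu>
      \<le> 1 + block_entropy \<nu> k + real k * max_pressure" by (simp add: algebra_simps)
  moreover have "(\<integral>x. - log 2 (smooth k (word k x)) + (\<Sum>i<k. \<phi> (word k x ! i)) \<partial>?\<mu>)
      = (\<integral>x. - log 2 (smooth k (word k x)) \<partial>?\<mu>) + real k * mean_phi ?\<mu>"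
    using integral_word_sum[OF LD(8), of k]
      Bochner_Integration.integral_add[OF M.integrable_simple[OF sf, of "\<lambda>v. - log 2 (smooth k v)"],
        of "\<lambda>x. \<Sum>i<k. \<phi> (x (int i))"]
    unfolding sum_word by simp
  ultimately show ?thesis by simp
qed

text \<open>\<open>mustar\<close> gives the lower bound at every n. For the upper one,
  \<open>birkhoff_uniform_bound\<close> turns the bound of \<open>integral_smooth_le\<close> on
  integrals into one on orbit sums, which \<open>partition_sum_bound\<close> converts into a bound
  on words.\<close>

lemma pressure_limit:
  assumes sub: "meas_subordinate X \<nu>"
  shows "(\<lambda>n. log 2 (partition_sum X \<phi> n) / real n) \<longlonglongrightarrow> max_pressure"
proof -
  have X: "subshift X" and M: "Minv X = {distr L Omega Mmap | L. L \<in> couplings}"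
    using sub by (auto simp: meas_subordinate_def couplings_def)
  have ne: "X \<noteq> {}" using X by (simp add: subshift_def)
  have low: "max_pressure \<le> log 2 (partition_sum X \<phi> n) / real n" if "n > 0" for n
  proof -
    have "mustar \<in> Minv X" unfolding M mustar_def using Lstar_coupling by blast
    then have "real n * max_pressure \<le> log 2 (partition_sum X \<phi> n)"
      using block_entropy_le_partition_sum[OF _ ne, of mustar n] block_entropy_mustar_ge[of n]
      by (simp add: algebra_simps)
    with that show ?thesis by (simp add: pos_le_divide_eq mult.commute)
  qed
  show ?thesis
  proof (rule tendstoI)
    fix e :: real assume e: "0 < e"
    \<comment> \<open>Per symbol, the bit lost in the mixture and the base entropy both vanish as k
      grows; a fixed k leaves strict room for the compactness argument.\<close>
    have "(\<lambda>k. 1 / real k + block_entropy \<nu> k / real k) \<longlonglongrightarrow> 0 + 0"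
      by (intro tendsto_add lim_1_over_n block_entropy_nu)
    then have "\<forall>\<^sub>F k in sequentially. 1 / real k + block_entropy \<nu> k / real k < e / 2"
      using e by (intro order_tendstoD(2)) auto
    with eventually_gt_at_top[of 0] have "\<forall>\<^sub>F k in sequentially. 0 < k \<and> 1 / real k + block_entropy \<nu> k / real k < e / 2"
      by eventually_elim simp
    then obtain k where k: "0 < k" and ke: "1 / real k + block_entropy \<nu> k / real k < e / 2"
      by (auto simp: eventually_sequentially)
    have ke': "1 + block_entropy \<nu> k + real k * max_pressure < real k * (max_pressure + e / 2)"
      using ke k by (simp add: field_simps)
    define h where "h v = - log 2 (smooth k v) + (\<Sum>i<k. \<phi> (v ! i))" for v
    have "(\<integral>x. h (word k x) \<partial>\<mu>) < real k * (max_pressure + e / 2)" if \<mu>: "\<mu> \<in> Minv X" for \<mu>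
    proof -
      obtain L where "L \<in> couplings" "\<mu> = distr L Omega Mmap" using \<mu> M by auto
      with integral_smooth_le[of L k] ke' show ?thesis by (simp add: h_def)
    qed
    from birkhoff_uniform_bound[OF X this] obtain N where
      N: "\<And>n x. n \<ge> N \<Longrightarrow> x \<in> X \<Longrightarrow> (\<Sum>m<n. h (word k ((shift ^^ m) x))) < real n * (real k * (max_pressure + e / 2))"
      by blast
    have "\<exists>D. \<forall>n\<ge>N + k. log 2 (partition_sum X \<phi> n) \<le> real n * (max_pressure + e / 2) + D"
      by (rule partition_sum_bound[OF X k smooth_pos sum_smooth]) (use N in \<open>force simp: h_def intro: less_imp_le\<close>)
    then obtain D where D: "\<And>n. n \<ge> N + k \<Longrightarrow> log 2 (partition_sum X \<phi> n) \<le> real n * (max_pressure + e / 2) + D"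
      by blast
    have "\<forall>\<^sub>F n in sequentially. D / real n < e / 2"
      using order_tendstoD(2)[OF lim_const_over_n, of "e / 2" D] e by simp
    with eventually_ge_at_top[of "N + k"]
    show "\<forall>\<^sub>F n in sequentially. dist (log 2 (partition_sum X \<phi> n) / real n) max_pressure < e"
    proof eventually_elim
      case (elim n)
      then have n: "n > 0" using k by simp
      have "log 2 (partition_sum X \<phi> n) / real n \<le> (real n * (max_pressure + e / 2) + D) / real n"
        using D[OF elim(1)] by (rule divide_right_mono) simp
      also have "\<dots> = max_pressure + e / 2 + D / real n" using n by (simp add: add_divide_distrib)
      finally show ?case using low[OF n] elim(2) unfolding dist_real_def by linarith
    qed
  qed
qed

end

theorem theorem5p2:
  fixes X :: "config set" and \<nu> :: "config measure" and \<phi> :: "bool \<Rightarrow> real"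
  assumes "\<nu> \<in> Minv UNIV"
    and "meas_subordinate X \<nu>"
    and "entropy_ms \<nu> = 0"
  shows "pressure X (\<lambda>x. \<phi> (x 0)) =
           sym_prob \<nu> False * \<phi> False
           + sym_prob \<nu> True * log 2 (2 powr \<phi> False + 2 powr \<phi> True)
         \<and> (\<forall>\<mu>. equilibrium_state X (\<lambda>x. \<phi> (x 0)) \<mu> \<longleftrightarrow>
           \<mu> = distr (\<nu> \<Otimes>\<^sub>M bernoulli_shift
                   (2 powr \<phi> False / (2 powr \<phi> False + 2 powr \<phi> True))) Omega Mmap)"
proof -
  interpret zero_entropy_base \<nu> \<phi> by unfold_locales (use assms in auto)
  have M: "Minv X = {distr L Omega Mmap | L. L \<in> couplings}"
    using assms(2) by (auto simp: meas_subordinate_def couplings_def)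
  have P: "pressure X (\<lambda>x. \<phi> (x 0)) = max_pressure"
    unfolding pressure_def partition_sum_eq using pressure_limit[OF assms(2)] by (rule limI)
  have "equilibrium_state X (\<lambda>x. \<phi> (x 0)) \<mu> \<longleftrightarrow> \<mu> = mustar" for \<mu>
  proof
    assume "equilibrium_state X (\<lambda>x. \<phi> (x 0)) \<mu>"
    then have "\<mu> \<in> Minv X" "entropy_ms \<mu> + mean_phi \<mu> = max_pressure"
      by (auto simp: equilibrium_state_def P mean_phi_def)
    then show "\<mu> = mustar" using equilibrium_unique unfolding M by auto
  next
    assume "\<mu> = mustar"
    moreover have "mustar \<in> Minv X" unfolding M mustar_def using Lstar_coupling by blast
    ultimately show "equilibrium_state X (\<lambda>x. \<phi> (x 0)) \<mu>"
      using entropy_mustar by (simp add: equilibrium_state_def P mean_phi_def)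
  qed
  then show ?thesis using P max_pressure_eq by (simp add: mustar_def Lstar_def p_def)
qed

end
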